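(* There is a constant $C$ depending only on $n$ with the following property. Let $u$ be a $C^1$ solution of $\Delta u=f$ in $B_1(0)\subset\mathbb{R}^n$, where $f$ is a continuous function on $B_1(0)$. Then for any $x,y\in B_{1/2}(0)$, $$|Du(x)-Du(y)|\le C\,d\left(\sup_{B_1(0)}|u|+\sup_{B_1(0)}|f|+\int_d^1\frac{\omega(r)}{r}\,dr\right),$$ where $d=|x-y|$ and $\omega(r)=\sup\{|f(p)-f(q)|: p,q\in B_1(0),\ |p-q|<r\}$.
   Context: $B_r(0)$ is the open ball of radius $r$ centered at the origin in $\mathbb{R}^n$. $Du$ is the gradient of $u$. Since $u$ is only assumed $C^1$, the equation $\Delta u=f$ is understood in the sense of distributions. The suprema on the right-hand side may be infinite, in which case the inequality is vacuous; the case $d=0$ is trivial. *)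

theory Defs
  imports "HOL-Analysis.Analysis"
begin

definition partial_deriv :: "'a::euclidean_space \<Rightarrow> ('a \<Rightarrow> real) \<Rightarrow> 'a \<Rightarrow> real"
  where "partial_deriv b \<phi> x = frechet_derivative \<phi> (at x) b"

definition laplacian :: "('a::euclidean_space \<Rightarrow> real) \<Rightarrow> 'a \<Rightarrow> real"
  where "laplacian \<phi> x = (\<Sum>b\<in>Basis. partial_deriv b (partial_deriv b \<phi>) x)"

text \<open>Differentiability is part of the recursive clause because \<^const>\<open>frechet_derivative\<close> is
  an unspecified value at points where the derivative does not exist.\<close>

primrec Ck :: "nat \<Rightarrow> ('a::euclidean_space \<Rightarrow> real) \<Rightarrow> bool"
  where
    "Ck 0 \<phi> \<longleftrightarrow> continuous_on UNIV \<phi>"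
  | "Ck (Suc k) \<phi> \<longleftrightarrow>
       (\<forall>x. \<phi> differentiable (at x)) \<and> (\<forall>b\<in>Basis. Ck k (partial_deriv b \<phi>))"

definition test_function_on :: "'a::euclidean_space set \<Rightarrow> ('a \<Rightarrow> real) \<Rightarrow> bool"
  where "test_function_on S \<phi> \<longleftrightarrow>
    (\<forall>k. Ck k \<phi>) \<and> compact (closure {x. \<phi> x \<noteq> 0}) \<and> closure {x. \<phi> x \<noteq> 0} \<subseteq> S"

text \<open>The equation \<open>\<Delta>u = f\<close> in the sense of distributions on \<open>S\<close>, for \<open>S\<close> open and
  \<open>u\<close>, \<open>f\<close> continuous on \<open>S\<close>: the integrands are then continuous with compact support in \<open>S\<close>,
  so both integrals exist. Values of \<open>u\<close> and \<open>f\<close> outside \<open>S\<close> play no role.\<close>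

definition laplace_eq_distributional ::
    "'a::euclidean_space set \<Rightarrow> ('a \<Rightarrow> real) \<Rightarrow> ('a \<Rightarrow> real) \<Rightarrow> bool"
  where "laplace_eq_distributional S u f \<longleftrightarrow>
    (\<forall>\<phi>. test_function_on S \<phi> \<longrightarrow>
      (LINT x:S|lborel. u x * laplacian \<phi> x) = (LINT x:S|lborel. f x * \<phi> x))"

definition C1_with_gradient_on ::
    "'a::euclidean_space set \<Rightarrow> ('a \<Rightarrow> real) \<Rightarrow> ('a \<Rightarrow> 'a) \<Rightarrow> bool"
  where "C1_with_gradient_on S u Du \<longleftrightarrow>
    (\<forall>x\<in>S. GDERIV u x :> Du x) \<and> continuous_on S Du"

text \<open>Suprema are taken in \<^typ>\<open>ennreal\<close>, so that they are \<open>\<infinity>\<close> for unbounded functions.\<close>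

definition sup_abs :: "'a set \<Rightarrow> ('a \<Rightarrow> real) \<Rightarrow> ennreal"
  where "sup_abs S g = (SUP x\<in>S. ennreal \<bar>g x\<bar>)"

definition oscillation_modulus ::
    "'a::metric_space set \<Rightarrow> ('a \<Rightarrow> real) \<Rightarrow> real \<Rightarrow> ennreal"
  where "oscillation_modulus S f r =
    (SUP (p, q) \<in> {(p, q). p \<in> S \<and> q \<in> S \<and> dist p q < r}. ennreal \<bar>f p - f q\<bar>)"

end

(* Fix a smooth g with g(s) = 0 for s >= 1/16. The radial functions Psi_r(w) = g(|w|^2/r^2) and
   phi_r(w) = 2 g'(|w|^2/r^2) / r^n satisfy d/dr phi_r = - r^(1-n) Laplacian(Psi_r). Testing the
   equation with Psi_r(. - p) and integrating over r therefore gives, with M = integral of phi_1 < 0,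
     M u(p) = (u * phi_1)(p) + integral over 0 < r < 1 of r^(1-n) (f * Psi_r)(p).
   Take the second difference of this identity over the four points x + v, x, y + v, y and divide
   by |v|. In the last integral, for r < d one uses that Psi_r is Lipschitz; for r > d the second
   difference of Psi_r has mean zero and is O(|v| d / r^2), so f may be replaced by its oscillation
   at scale r, which produces omega(r)/r. Letting v tend to 0 in the direction of Du(x) - Du(y)
   yields the gradient bound without ever differentiating the integrals in p. *)

theory Submission
  imports Defs "HOL-Computational_Algebra.Polynomial"
begin

text \<open>The obstacle: second derivatives of the fundamental solution have size |w|^(-n), whose
  integral diverges logarithmically at the origin, and \<open>u\<close> itself need not have second
  derivatives. Superposing cutoffs over scales handles both. Up to a constant factor and a smooth
  term, the integral of r^(1-n) Psi_r over 0 < r < 1 is a truncated fundamental solution, in every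
  dimension alike, so that neither polar coordinates nor a separate logarithmic case for n = 2
  arises. Each single scale is an honest test function, and the logarithmic divergence becomes
  visible as the measure dr/r.

  The threshold 1/16 gives Psi_r support in radius r/4. With |v| < d/4 and d < 1 the four centres
  have norm below 3/4, so all scales up to 1 fit into the unit ball; for r >= d all four supports
  lie within r of the midpoint of \<open>x\<close> and \<open>y\<close>. The constant C depends on n
  alone because g is fixed once and for all: it is built from the volume of the unit ball, the
  difference bounds of g and 1/|M|.\<close>

section \<open>A smooth compactly supported profile with all its derivatives\<close>

definition flat_exp :: "real poly \<Rightarrow> real \<Rightarrow> real"
  where "flat_exp P x = (if x > 0 then poly P (1 / x) * exp (- (1 / x)) else 0)"

lemma poly_times_exp_minus_tendsto_0:
  fixes P :: "real poly"
  shows "((\<lambda>t. poly P t * exp (- t)) \<longlongrightarrow> 0) at_top"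
proof -
  have "((\<lambda>t. \<Sum>i\<le>degree P. coeff P i * (t ^ i / exp t)) \<longlongrightarrow> (\<Sum>i\<le>degree P. coeff P i * 0)) at_top"
    by (intro tendsto_intros tendsto_power_div_exp_0)
  moreover have "poly P t * exp (- t) = (\<Sum>i\<le>degree P. coeff P i * (t ^ i / exp t))" for t
    by (simp add: poly_altdef exp_minus sum_distrib_right divide_simps)
  ultimately show ?thesis by simp
qed

text \<open>With t = 1/x, so that dt/dx = -t^2, differentiating P(t) exp(-t) gives t^2 (P - P')(t)
  exp(-t). The family is therefore closed under differentiation, and smoothness at 0 has to be
  checked only once, for general \<open>P\<close>.\<close>

lemma DERIV_flat_exp:
  "DERIV (flat_exp P) x :> flat_exp ([:0, 0, 1:] * (P - pderiv P)) x"
proof (cases x "0::real" rule: linorder_cases)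
  case less
  have "DERIV (\<lambda>_. 0) x :> (0::real)" by simp
  then show ?thesis
    using less by (subst DERIV_cong_ev[OF refl _ refl, where g = "\<lambda>_. 0"])
      (auto simp: flat_exp_def intro!: eventually_mono[OF eventually_nhds_in_open[of "{..<0}"]])
next
  case greater
  have eq: "(poly (pderiv P) (1 / x) * (- (1 / x\<^sup>2))) * exp (- (1 / x)) +
      poly P (1 / x) * (exp (- (1 / x)) * (1 / x\<^sup>2)) = flat_exp ([:0, 0, 1:] * (P - pderiv P)) x"
    using greater by (simp add: flat_exp_def field_simps power2_eq_square)
  have "DERIV (\<lambda>x. 1 / x) x :> - (1 / x\<^sup>2)"
    using greater by (auto intro!: derivative_eq_intros simp: power2_eq_square)
  then have "DERIV (\<lambda>x. poly P (1 / x)) x :> poly (pderiv P) (1 / x) * (- (1 / x\<^sup>2))"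
    by (rule DERIV_chain2[OF poly_DERIV])
  then have "DERIV (\<lambda>x. poly P (1 / x) * exp (- (1 / x))) x :>
      flat_exp ([:0, 0, 1:] * (P - pderiv P)) x"
    unfolding eq[symmetric] using greater
    by (auto intro!: derivative_eq_intros simp: power2_eq_square)
  then show ?thesis
    using greater by (subst DERIV_cong_ev[OF refl _ refl, where g = "\<lambda>x. poly P (1 / x) * exp (- (1 / x))"])
      (auto simp: flat_exp_def intro!: eventually_mono[OF eventually_nhds_in_open[of "{0<..}"]])
next
  case equal
  have "((\<lambda>h. flat_exp P h / h) \<longlongrightarrow> 0) (at_right 0)"
  proof -
    \<comment> \<open>With t = 1/h the difference quotient at 0 is t P(t) exp(-t); the extra factor
      t is \<open>[:0, 1:]\<close>.\<close>
    have "((\<lambda>h. poly ([:0, 1:] * P) (inverse h) * exp (- inverse h)) \<longlongrightarrow> 0) (at_right (0::real))"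
      by (rule filterlim_compose[OF poly_times_exp_minus_tendsto_0 filterlim_inverse_at_top_right])
    then show ?thesis
      by (rule Lim_transform_eventually)
        (auto simp: flat_exp_def eventually_at_filter field_simps)
  qed
  moreover have "((\<lambda>h. flat_exp P h / h) \<longlongrightarrow> 0) (at_left 0)"
    by (rule tendsto_eventually) (auto simp: flat_exp_def eventually_at_filter)
  ultimately have "((\<lambda>h. flat_exp P h / h) \<longlongrightarrow> 0) (at 0)"
    by (simp add: filterlim_at_split)
  then show ?thesis
    using equal by (simp add: DERIV_def flat_exp_def)
qed

primrec flat_poly :: "nat \<Rightarrow> real poly"
  where
    "flat_poly 0 = 1"
  | "flat_poly (Suc k) = [:0, 0, 1:] * (flat_poly k - pderiv (flat_poly k))"

text \<open>The \<open>k\<close>-th derivative of \<open>s \<mapsto> exp (-1 / (1/16 - s))\<close>, extended by \<open>0\<close> to \<open>s \<ge> 1/16\<close>.\<close>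

definition cutoff :: "nat \<Rightarrow> real \<Rightarrow> real"
  where "cutoff k s = (-1) ^ k * flat_exp (flat_poly k) (1 / 16 - s)"

lemma DERIV_cutoff: "DERIV (cutoff k) s :> cutoff (Suc k) s"
proof -
  have "DERIV (\<lambda>s. flat_exp (flat_poly k) (1 / 16 - s)) s :>
      flat_exp (flat_poly (Suc k)) (1 / 16 - s) * (- 1)"
    by (rule DERIV_chain2[OF DERIV_flat_exp[of "flat_poly k", folded flat_poly.simps(2)]])
      (auto intro!: derivative_eq_intros)
  then have "DERIV (\<lambda>s. (-1) ^ k * flat_exp (flat_poly k) (1 / 16 - s)) s :>
      (-1) ^ k * (flat_exp (flat_poly (Suc k)) (1 / 16 - s) * (- 1))"
    by (rule DERIV_cmult)
  then show ?thesis
    unfolding cutoff_def[abs_def] by simp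
qed

lemma cutoff_eq_0: "s \<ge> 1 / 16 \<Longrightarrow> cutoff k s = 0"
  by (simp add: cutoff_def flat_exp_def)

text \<open>\<open>flat_poly 1\<close> is t^2, so the first derivative is -t^2 exp(-t) with t > 0.
  This strict sign is what makes the mass of the kernel nonzero.\<close>

lemma cutoff_1_neg: "s < 1 / 16 \<Longrightarrow> cutoff 1 s < 0"
  by (simp add: cutoff_def flat_exp_def)

lemma cutoff_measurable [measurable]: "cutoff k \<in> borel_measurable borel"
  by (intro borel_measurable_continuous_onI continuous_at_imp_continuous_on ballI
      DERIV_isCont[OF DERIV_cutoff])

section \<open>Closure properties of the classes \<open>Ck\<close>\<close>

lemma partial_deriv_eqI:
  assumes "(\<phi> has_derivative D) (at x)"
  shows "partial_deriv b \<phi> x = D b"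
  unfolding partial_deriv_def using frechet_derivative_at[OF assms] by simp

lemma Ck_Suc_imp_Ck: "Ck (Suc k) \<phi> \<Longrightarrow> Ck k \<phi>"
proof (induction k arbitrary: \<phi>)
  case 0
  then show ?case
    by (auto intro!: continuous_at_imp_continuous_on differentiable_imp_continuous_within)
next
  case (Suc k)
  then show ?case by (metis Ck.simps(2))
qed

lemma Ck_const: "Ck k (\<lambda>_. c)"
proof (induction k arbitrary: c)
  case (Suc k)
  have "partial_deriv b (\<lambda>_::'a. c) = (\<lambda>_. 0)" for b
    by (rule ext, rule partial_deriv_eqI) (rule has_derivative_const)
  then show ?case using Suc by simp
qed simp

lemma Ck_add: "Ck k \<phi> \<Longrightarrow> Ck k \<psi> \<Longrightarrow> Ck k (\<lambda>x. \<phi> x + \<psi> x)"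
proof (induction k arbitrary: \<phi> \<psi>)
  case 0
  then show ?case by (auto intro: continuous_intros)
next
  case (Suc k)
  then have "(\<phi> has_derivative frechet_derivative \<phi> (at x)) (at x)"
      "(\<psi> has_derivative frechet_derivative \<psi> (at x)) (at x)" for x
    by (auto simp: frechet_derivative_works)
  then have "partial_deriv b (\<lambda>x. \<phi> x + \<psi> x) = (\<lambda>x. partial_deriv b \<phi> x + partial_deriv b \<psi> x)" for b
    by (intro ext, subst partial_deriv_eqI[OF has_derivative_add])
      (auto simp: partial_deriv_def)
  then show ?case using Suc by simp
qed

text \<open>The product rule leaves one factor undifferentiated, and the induction needs that factor
  in class \<open>k\<close>; \<open>Ck_Suc_imp_Ck\<close> lowers its order.\<close>

lemma Ck_mult: "Ck k \<phi> \<Longrightarrow> Ck k \<psi> \<Longrightarrow> Ck k (\<lambda>x. \<phi> x * \<psi> x)"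
proof (induction k arbitrary: \<phi> \<psi>)
  case 0
  then show ?case by (auto intro: continuous_intros)
next
  case (Suc k)
  then have "(\<phi> has_derivative frechet_derivative \<phi> (at x)) (at x)"
      "(\<psi> has_derivative frechet_derivative \<psi> (at x)) (at x)" for x
    by (auto simp: frechet_derivative_works)
  then have "partial_deriv b (\<lambda>x. \<phi> x * \<psi> x) =
      (\<lambda>x. \<phi> x * partial_deriv b \<psi> x + partial_deriv b \<phi> x * \<psi> x)" for b
    by (intro ext, subst partial_deriv_eqI[OF has_derivative_mult])
      (auto simp: partial_deriv_def)
  moreover have "Ck k (\<lambda>x. \<phi> x * partial_deriv b \<psi> x + partial_deriv b \<phi> x * \<psi> x)"
    if "b \<in> Basis" for b
    using that Suc.prems Ck_Suc_imp_Ck[OF Suc.prems(1)] Ck_Suc_imp_Ck[OF Suc.prems(2)]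
    by (intro Ck_add Suc.IH) auto
  ultimately show ?case using Suc.prems by simp
qed

text \<open>The chain rule replaces \<open>G j\<close> by \<open>G (Suc j)\<close>, so the induction
  runs over a whole tower of derivatives with \<open>j\<close> arbitrary.\<close>

lemma Ck_compose_real:
  assumes G: "\<And>j s. DERIV (G j) s :> G (Suc j) s" and \<phi>: "\<And>k. Ck k \<phi>"
  shows "Ck k (\<lambda>x. G j (\<phi> x))"
proof (induction k arbitrary: j)
  case 0
  have "continuous_on UNIV (G j)"
    by (intro continuous_at_imp_continuous_on ballI DERIV_isCont[OF G])
  then have "continuous_on UNIV (\<lambda>x. G j (\<phi> x))"
    by (rule continuous_on_compose2) (use \<phi>[of 0] in auto)
  then show ?case by simp
next
  case (Suc k)
  have \<phi>': "(\<phi> has_derivative frechet_derivative \<phi> (at x)) (at x)" for x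
    using \<phi>[of "Suc 0"] by (auto simp: frechet_derivative_works)
  have *: "((\<lambda>x. G j (\<phi> x)) has_derivative
      (\<lambda>h. G (Suc j) (\<phi> x) * frechet_derivative \<phi> (at x) h)) (at x)" for x
    using has_derivative_compose[OF \<phi>' G[of j "\<phi> x", unfolded has_field_derivative_def]] by simp
  have "partial_deriv b (\<lambda>x. G j (\<phi> x)) = (\<lambda>x. G (Suc j) (\<phi> x) * partial_deriv b \<phi> x)" for b
    by (rule ext) (simp add: partial_deriv_eqI[OF *], simp add: partial_deriv_def)
  moreover have "Ck k (\<lambda>x. G (Suc j) (\<phi> x) * partial_deriv b \<phi> x)" if "b \<in> Basis" for b
    using Suc.IH \<phi>[of "Suc k"] that by (intro Ck_mult) auto
  moreover have "(\<lambda>x. G j (\<phi> x)) differentiable at x" for x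
    using * by (auto simp: differentiable_def)
  ultimately show ?case by simp
qed

lemma Ck_inner: "Ck k (\<lambda>x. x \<bullet> a)"
proof (cases k)
  case 0
  then show ?thesis by (auto intro: continuous_intros)
next
  case (Suc m)
  have *: "((\<lambda>x. x \<bullet> a) has_derivative (\<lambda>h. h \<bullet> a)) (at x)" for x
    by (auto intro!: derivative_eq_intros)
  have "partial_deriv b (\<lambda>x. x \<bullet> a) = (\<lambda>_. b \<bullet> a)" for b
    by (rule ext) (rule partial_deriv_eqI[OF *])
  then show ?thesis
    using Suc * Ck_const by (auto simp: differentiable_def)
qed

lemma Ck_sum: "finite I \<Longrightarrow> (\<And>i. i \<in> I \<Longrightarrow> Ck k (\<phi> i)) \<Longrightarrow> Ck k (\<lambda>x. \<Sum>i\<in>I. \<phi> i x)"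
  by (induction I rule: finite_induct) (auto intro: Ck_const Ck_add)

lemma Ck_norm_sq: "Ck k (\<lambda>x. (norm (x - p))\<^sup>2 / c)"
proof -
  have "Ck k (\<lambda>x. (\<Sum>b\<in>Basis. (x \<bullet> b + - (p \<bullet> b)) * (x \<bullet> b + - (p \<bullet> b))) * inverse c)"
    by (intro Ck_mult Ck_sum Ck_add Ck_inner Ck_const) auto
  moreover have "(\<Sum>b\<in>Basis. (x \<bullet> b + - (p \<bullet> b)) * (x \<bullet> b + - (p \<bullet> b))) = (norm (x - p))\<^sup>2" for x
    unfolding power2_norm_eq_inner by (subst euclidean_inner) (simp add: inner_diff_left)
  ultimately show ?thesis by (simp add: divide_inverse)
qed


section \<open>Radial cutoffs as test functions\<close>

text \<open>For \<open>k = 0\<close> this is Psi_r. For larger \<open>k\<close> the profile is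
  differentiated, not the function of \<open>w\<close>. Using the squared norm keeps it smooth at
  the origin.\<close>

definition radial_cutoff :: "nat \<Rightarrow> real \<Rightarrow> 'a::euclidean_space \<Rightarrow> real"
  where "radial_cutoff k r w = cutoff k ((norm w)\<^sup>2 / r\<^sup>2)"

lemma radial_cutoff_eq_0:
  assumes "r > 0" "norm w \<ge> r / 4"
  shows "radial_cutoff k r w = 0"
proof -
  have "(r / 4)\<^sup>2 \<le> (norm w)\<^sup>2"
    using assms by (intro power_mono) auto
  then show ?thesis
    unfolding radial_cutoff_def using assms by (intro cutoff_eq_0) (simp add: field_simps power2_eq_square)
qed

text \<open>All bounds at scale \<open>r\<close> are transported from scale 1 by this identity. At
  \<open>r = 0\<close> both sides are \<open>cutoff k 0\<close>, since division by zero gives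
  zero.\<close>

lemma radial_cutoff_scale: "radial_cutoff k r w = radial_cutoff k 1 (w /\<^sub>R r)"
  by (simp add: radial_cutoff_def power_mult_distrib divide_simps)

lemma test_function_radial_cutoff:
  assumes "r > 0" "cball p (r / 4) \<subseteq> S"
  shows "test_function_on S (\<lambda>z. radial_cutoff k r (z - p))"
proof -
  have "{z. radial_cutoff k r (z - p) \<noteq> 0} \<subseteq> cball p (r / 4)"
  proof
    fix z assume "z \<in> {z. radial_cutoff k r (z - p) \<noteq> 0}"
    then have "\<not> r / 4 \<le> norm (z - p)"
      using radial_cutoff_eq_0[OF assms(1)] by auto
    then show "z \<in> cball p (r / 4)"
      by (simp add: dist_norm norm_minus_commute)
  qed
  then have cl: "closure {z. radial_cutoff k r (z - p) \<noteq> 0} \<subseteq> cball p (r / 4)"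
    by (rule closure_minimal) simp
  then have "compact (closure {z. radial_cutoff k r (z - p) \<noteq> 0})"
    by (meson bounded_cball bounded_subset closed_closure compact_eq_bounded_closed)
  moreover have "Ck m (\<lambda>z. radial_cutoff k r (z - p))" for m
    unfolding radial_cutoff_def by (intro Ck_compose_real[where G = cutoff] DERIV_cutoff Ck_norm_sq)
  ultimately show ?thesis
    unfolding test_function_on_def using cl assms(2) by blast
qed

section \<open>Lipschitz and second difference bounds for test functions\<close>

lemma test_function_bounded:
  assumes "test_function_on S \<phi>"
  obtains B where "B > 0" "\<And>x. \<bar>\<phi> x\<bar> \<le> B"
proof -
  let ?K = "closure {x. \<phi> x \<noteq> 0}"
  have "continuous_on ?K \<phi>" "compact ?K"
    using assms continuous_on_subset[of UNIV \<phi> ?K] Ck.simps(1)[of \<phi>] unfolding test_function_on_def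
    by blast+
  then have "bounded (\<phi> ` ?K)"
    by (intro compact_imp_bounded compact_continuous_image)
  then obtain B where B: "B > 0" "\<And>x. x \<in> ?K \<Longrightarrow> \<bar>\<phi> x\<bar> \<le> B"
    by (auto simp: bounded_pos)
  have "\<bar>\<phi> x\<bar> \<le> B" for x
  proof (cases "\<phi> x = 0")
    case False
    then show ?thesis using closure_subset[of "{x. \<phi> x \<noteq> 0}"] by (intro B) auto
  qed (use B in auto)
  then show ?thesis using that B(1) by blast
qed

lemma test_function_partial_deriv:
  assumes "test_function_on S \<phi>" "b \<in> Basis"
  shows "test_function_on S (partial_deriv b \<phi>)"
proof -
  let ?K = "closure {x. \<phi> x \<noteq> 0}"
  have "partial_deriv b \<phi> x = 0" if "x \<notin> ?K" for x
  proof -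
    have "(\<phi> has_derivative (\<lambda>_. 0)) (at x)"
    proof (rule has_derivative_transform_within_open)
      show "((\<lambda>_. 0) has_derivative (\<lambda>_. 0)) (at x)" by simp
      show "open (- ?K)" "x \<in> - ?K" using that by auto
      show "0 = \<phi> y" if "y \<in> - ?K" for y
        using that closure_subset[of "{x. \<phi> x \<noteq> 0}"] by auto
    qed
    then show ?thesis by (rule partial_deriv_eqI)
  qed
  then have "{x. partial_deriv b \<phi> x \<noteq> 0} \<subseteq> ?K" by auto
  then have "closure {x. partial_deriv b \<phi> x \<noteq> 0} \<subseteq> ?K"
    by (rule closure_minimal) simp
  moreover have "compact ?K" "?K \<subseteq> S"
    using assms by (auto simp: test_function_on_def)
  moreover have "Ck k (partial_deriv b \<phi>)" for k
    using assms Ck.simps(2)[of k \<phi>] unfolding test_function_on_def by blast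
  moreover from calculation have "compact (closure {x. partial_deriv b \<phi> x \<noteq> 0})"
    using compact_Int_closed[of ?K "closure {x. partial_deriv b \<phi> x \<noteq> 0}"] by (simp add: Int_absorb1)
  ultimately show ?thesis
    unfolding test_function_on_def by blast
qed

lemma lipschitz_if_partials_bounded:
  fixes \<phi> :: "'a::euclidean_space \<Rightarrow> real"
  assumes diff: "\<And>x. \<phi> differentiable at x"
    and K: "\<And>x b. b \<in> Basis \<Longrightarrow> \<bar>partial_deriv b \<phi> x\<bar> \<le> K"
  shows "\<bar>\<phi> x - \<phi> y\<bar> \<le> real DIM('a) * K * norm (x - y)"
proof -
  have D: "(\<phi> has_derivative frechet_derivative \<phi> (at x)) (at x)" for x
    using diff by (simp add: frechet_derivative_works)
  have "onorm (frechet_derivative \<phi> (at x)) \<le> real DIM('a) * K" for x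
  proof (rule onorm_le)
    fix h :: 'a
    have "frechet_derivative \<phi> (at x) h = (\<Sum>b\<in>Basis. (h \<bullet> b) * partial_deriv b \<phi> x)"
      using linear_sum[OF has_derivative_linear[OF D[of x]], of "\<lambda>b. (h \<bullet> b) *\<^sub>R b" Basis]
        linear_cmul[OF has_derivative_linear[OF D[of x]]]
      by (simp add: euclidean_representation partial_deriv_def)
    also have "\<bar>\<dots>\<bar> \<le> (\<Sum>b\<in>(Basis::'a set). norm h * K)"
      using K by (intro order_trans[OF sum_abs] sum_mono)
        (auto simp: abs_mult intro!: mult_mono Basis_le_norm)
    finally show "norm (frechet_derivative \<phi> (at x) h) \<le> real DIM('a) * K * norm h"
      by (simp add: mult_ac)
  qed
  then show ?thesis
    using differentiable_bound[of UNIV \<phi> "\<lambda>x. frechet_derivative \<phi> (at x)" "real DIM('a) * K" x y] D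
    by simp
qed

lemma test_function_differentiable: "test_function_on S \<phi> \<Longrightarrow> \<phi> differentiable at x"
  using Ck.simps(2)[of 0 \<phi>] unfolding test_function_on_def by blast

lemma test_function_partials_bounded:
  fixes \<phi> :: "'a::euclidean_space \<Rightarrow> real"
  assumes "test_function_on S \<phi>"
  obtains K where "K > 0" "\<And>x b. b \<in> Basis \<Longrightarrow> \<bar>partial_deriv b \<phi> x\<bar> \<le> K"
proof -
  have "\<forall>b\<in>Basis. \<exists>B. B > 0 \<and> (\<forall>x. \<bar>partial_deriv b \<phi> x\<bar> \<le> B)"
    using assms test_function_partial_deriv test_function_bounded by metis
  then obtain B where B: "\<And>b. b \<in> Basis \<Longrightarrow> B b > 0" "\<And>b x. b \<in> Basis \<Longrightarrow> \<bar>partial_deriv b \<phi> x\<bar> \<le> B b"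
    by metis
  show ?thesis
  proof (rule that)
    show "sum B Basis > 0" using B(1) by (intro sum_pos) auto
    show "\<bar>partial_deriv b \<phi> x\<bar> \<le> sum B Basis" if "b \<in> Basis" for x b
      using B(2)[OF that, of x] member_le_sum[of b Basis B] that B(1) by (auto intro: less_imp_le order_trans)
  qed
qed

lemma test_function_lipschitz:
  fixes \<phi> :: "'a::euclidean_space \<Rightarrow> real"
  assumes "test_function_on S \<phi>"
  obtains L where "L > 0" "\<And>x y. \<bar>\<phi> x - \<phi> y\<bar> \<le> L * norm (x - y)"
proof -
  obtain K where K: "K > 0" "\<And>x b. b \<in> Basis \<Longrightarrow> \<bar>partial_deriv b \<phi> x\<bar> \<le> K"
    using test_function_partials_bounded[OF assms] by blast
  show ?thesis
    using lipschitz_if_partials_bounded[OF test_function_differentiable[OF assms] K(2)] K(1)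
    by (intro that[of "real DIM('a) * K"]) auto
qed

text \<open>The partial derivatives of \<phi> are again test functions, hence Lipschitz. So the
  increment of \<phi> by \<open>v\<close> has partial derivatives of order |v|, and the Lipschitz
  estimate for this increment in the direction \<open>w\<close> supplies the factor |w|.\<close>

lemma test_function_second_difference:
  fixes \<phi> :: "'a::euclidean_space \<Rightarrow> real"
  assumes "test_function_on S \<phi>"
  obtains L where "L > 0"
    "\<And>a v w. \<bar>\<phi> (a + v + w) - \<phi> (a + v) - \<phi> (a + w) + \<phi> a\<bar> \<le> L * norm v * norm w"
proof -
  have "\<forall>b\<in>Basis. \<exists>L. L > 0 \<and> (\<forall>x y. \<bar>partial_deriv b \<phi> x - partial_deriv b \<phi> y\<bar> \<le> L * norm (x - y))"
    using test_function_lipschitz[OF test_function_partial_deriv[OF assms]] by metis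
  then obtain B where B: "\<And>b. b \<in> Basis \<Longrightarrow> B b > 0"
      "\<And>b x y. b \<in> Basis \<Longrightarrow> \<bar>partial_deriv b \<phi> x - partial_deriv b \<phi> y\<bar> \<le> B b * norm (x - y)"
    by metis
  define K where "K = sum B Basis"
  have "K > 0" unfolding K_def using B(1) by (intro sum_pos) auto
  have K: "\<bar>partial_deriv b \<phi> x - partial_deriv b \<phi> y\<bar> \<le> K * norm (x - y)" if "b \<in> Basis" for b x y
  proof -
    have "B b \<le> K"
      unfolding K_def using that B(1) by (intro member_le_sum) (auto intro: less_imp_le)
    then show ?thesis
      using B(2)[OF that, of x y] by (meson mult_right_mono norm_ge_zero order_trans)
  qed
  have "\<bar>\<phi> (a + v + w) - \<phi> (a + v) - \<phi> (a + w) + \<phi> a\<bar> \<le> real DIM('a) * K * norm v * norm w" for a v w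
  proof -
    let ?\<psi> = "\<lambda>x. \<phi> (x + v) - \<phi> x"
    have D: "(\<phi> has_derivative frechet_derivative \<phi> (at x)) (at x)" for x
      using test_function_differentiable[OF assms] by (simp add: frechet_derivative_works)
    have "((\<lambda>x. \<phi> (x + v)) has_derivative frechet_derivative \<phi> (at (x + v))) (at x)" for x
      by (rule has_derivative_compose[where f = "\<lambda>x. x + v" and f' = "\<lambda>h. h"])
        (auto intro!: derivative_eq_intros D)
    from has_derivative_diff[OF this D]
    have \<psi>: "(?\<psi> has_derivative (\<lambda>h. frechet_derivative \<phi> (at (x + v)) h - frechet_derivative \<phi> (at x) h)) (at x)" for x .
    have "\<bar>?\<psi> (a + w) - ?\<psi> a\<bar> \<le> real DIM('a) * (K * norm v) * norm (a + w - a)"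
    proof (rule lipschitz_if_partials_bounded)
      show "?\<psi> differentiable at x" for x
        using \<psi> by (auto simp: differentiable_def)
      show "\<bar>partial_deriv b ?\<psi> x\<bar> \<le> K * norm v" if "b \<in> Basis" for x b
        unfolding partial_deriv_eqI[OF \<psi>] using K[OF that, of "x + v" x] by (simp add: partial_deriv_def)
    qed
    then show ?thesis by (simp add: algebra_simps)
  qed
  then show ?thesis using \<open>K > 0\<close> by (intro that[of "real DIM('a) * K"]) auto
qed

section \<open>The Laplacian of the cutoff as a derivative in the scale\<close>

text \<open>This is g''(s) |Ds|^2 + g'(s) \<Delta>s for s = |w|^2/r^2, where |Ds|^2 = 4 |w|^2/r^4
  and \<Delta>s = 2n/r^2.\<close>

definition radial_laplacian :: "real \<Rightarrow> 'a::euclidean_space \<Rightarrow> real"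
  where "radial_laplacian r w =
    4 * (norm w)\<^sup>2 / r ^ 4 * radial_cutoff 2 r w + 2 * real DIM('a) / r\<^sup>2 * radial_cutoff 1 r w"

lemma has_derivative_radial_cutoff:
  assumes "r > 0"
  shows "((\<lambda>z. radial_cutoff k r (z - p)) has_derivative
    (\<lambda>h. radial_cutoff (Suc k) r (z - p) * (2 * ((z - p) \<bullet> h) / r\<^sup>2))) (at z)"
proof -
  have "((\<lambda>z. (norm (z - p))\<^sup>2) has_derivative (\<lambda>h. 2 * ((z - p) \<bullet> h))) (at z)"
    unfolding power2_norm_eq_inner
    by (auto intro!: derivative_eq_intros simp: inner_commute)
  then have "((\<lambda>z. (norm (z - p))\<^sup>2 / r\<^sup>2) has_derivative (\<lambda>h. 2 * ((z - p) \<bullet> h) / r\<^sup>2)) (at z)"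
    by (rule bounded_linear.has_derivative[OF bounded_linear_divide])
  from has_derivative_compose[OF this DERIV_cutoff[of k, unfolded has_field_derivative_def]]
  show ?thesis
    unfolding radial_cutoff_def by simp
qed

lemma laplacian_radial_cutoff:
  fixes p :: "'a::euclidean_space"
  assumes "r > 0"
  shows "laplacian (\<lambda>z. radial_cutoff 0 r (z - p)) z = radial_laplacian r (z - p)"
proof -
  have 1: "partial_deriv b (\<lambda>z. radial_cutoff 0 r (z - p)) =
      (\<lambda>z. radial_cutoff 1 r (z - p) * (2 * ((z - p) \<bullet> b) / r\<^sup>2))" for b :: 'a
    by (rule ext) (simp add: partial_deriv_eqI[OF has_derivative_radial_cutoff[OF assms]])
  have "((\<lambda>z. 2 * ((z - p) \<bullet> b) / r\<^sup>2) has_derivative (\<lambda>h. 2 * (h \<bullet> b) / r\<^sup>2)) (at z)" for b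
    by (rule bounded_linear.has_derivative[OF bounded_linear_divide])
      (auto intro!: derivative_eq_intros)
  from has_derivative_mult[OF has_derivative_radial_cutoff[OF assms] this]
  have "partial_deriv b (partial_deriv b (\<lambda>z. radial_cutoff 0 r (z - p))) z =
      radial_cutoff 1 r (z - p) * (2 * (b \<bullet> b) / r\<^sup>2) +
      radial_cutoff 2 r (z - p) * (2 * ((z - p) \<bullet> b) / r\<^sup>2) * (2 * ((z - p) \<bullet> b) / r\<^sup>2)" for b
    unfolding 1 by (rule partial_deriv_eqI[THEN trans]) (simp add: numeral_2_eq_2)
  then have "partial_deriv b (partial_deriv b (\<lambda>z. radial_cutoff 0 r (z - p))) z =
      2 / r\<^sup>2 * radial_cutoff 1 r (z - p) +
      4 / r ^ 4 * radial_cutoff 2 r (z - p) * (((z - p) \<bullet> b) * ((z - p) \<bullet> b))" if "b \<in> Basis" for b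
    using that by (simp add: power2_eq_square power4_eq_xxxx mult_ac)
  then have "laplacian (\<lambda>z. radial_cutoff 0 r (z - p)) z =
      (\<Sum>b\<in>(Basis::'a set). 2 / r\<^sup>2 * radial_cutoff 1 r (z - p)) +
      (\<Sum>b\<in>Basis. 4 / r ^ 4 * radial_cutoff 2 r (z - p) * (((z - p) \<bullet> b) * ((z - p) \<bullet> b)))"
    unfolding laplacian_def sum.distrib[symmetric] by (intro sum.cong refl)
  also have "(\<Sum>b\<in>Basis. 4 / r ^ 4 * radial_cutoff 2 r (z - p) * (((z - p) \<bullet> b) * ((z - p) \<bullet> b))) =
      4 / r ^ 4 * radial_cutoff 2 r (z - p) * (norm (z - p))\<^sup>2"
    unfolding sum_distrib_left[symmetric] power2_norm_eq_inner euclidean_inner[of "z - p" "z - p"] ..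
  finally show ?thesis
    by (simp add: radial_laplacian_def mult_ac)
qed

text \<open>Normalised so that its derivative in \<open>r\<close> is \<open>- r\<^sup>1\<^sup>-\<^sup>n\<close> times the Laplacian of
  \<^term>\<open>radial_cutoff 0 r\<close>; the factor \<open>r\<^sup>1\<^sup>-\<^sup>n\<close> is written \<open>r / r ^ n\<close>.\<close>

definition radial_kernel :: "real \<Rightarrow> 'a::euclidean_space \<Rightarrow> real"
  where "radial_kernel r w = 2 * radial_cutoff 1 r w / r ^ DIM('a)"

text \<open>The two terms match separately: differentiating g' in \<open>r\<close> produces the term
  with g'' and the factor |w|^2, while differentiating r^(-n) produces the term with n g'.\<close>

lemma DERIV_radial_kernel:
  fixes w :: "'a::euclidean_space"
  assumes r: "r > 0"
  shows "DERIV (\<lambda>r. radial_kernel r w) r :> - (r / r ^ DIM('a) * radial_laplacian r w)"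
proof -
  obtain m where m: "DIM('a) = Suc m"
    using DIM_positive[where 'a = 'a] gr0_implies_Suc by blast
  have "DERIV (\<lambda>r. (norm w)\<^sup>2 / r\<^sup>2) r :> - 2 * (norm w)\<^sup>2 / r ^ 3"
    using r by (auto intro!: derivative_eq_intros simp: field_simps power2_eq_square power3_eq_cube)
  from DERIV_chain2[OF DERIV_cutoff this]
  have 1: "DERIV (\<lambda>r. radial_cutoff 1 r w) r :> radial_cutoff 2 r w * (- 2 * (norm w)\<^sup>2 / r ^ 3)"
    by (simp add: radial_cutoff_def numeral_2_eq_2)
  have "DERIV (\<lambda>r. r ^ DIM('a)) r :> real DIM('a) * r ^ m"
    using DERIV_pow[of "DIM('a)" r] by (simp add: m)
  from DERIV_divide[OF DERIV_cmult[OF 1, of 2] this]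
  have "DERIV (\<lambda>r. radial_kernel r w) r :>
     (2 * (radial_cutoff 2 r w * (- 2 * (norm w)\<^sup>2 / r ^ 3)) * r ^ DIM('a) -
      2 * radial_cutoff 1 r w * (real DIM('a) * r ^ m)) / (r ^ DIM('a) * r ^ DIM('a))"
    using r unfolding radial_kernel_def by simp
  also have "(2 * (radial_cutoff 2 r w * (- 2 * (norm w)\<^sup>2 / r ^ 3)) * r ^ DIM('a) -
      2 * radial_cutoff 1 r w * (real DIM('a) * r ^ m)) / (r ^ DIM('a) * r ^ DIM('a)) =
      - (r / r ^ DIM('a) * radial_laplacian r w)"
    using r unfolding radial_laplacian_def m
    by (simp add: field_simps power2_eq_square power3_eq_cube power4_eq_xxxx)
  finally show ?thesis .
qed


section \<open>Measurability, size and mass of the radial kernels\<close>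

lemma radial_cutoff_measurable [measurable (raw)]:
  assumes [measurable]: "\<rho> \<in> borel_measurable M" "\<omega> \<in> borel_measurable M"
  shows "(\<lambda>x. radial_cutoff k (\<rho> x) (\<omega> x)) \<in> borel_measurable M"
  unfolding radial_cutoff_def by measurable

lemma radial_laplacian_measurable [measurable (raw)]:
  assumes [measurable]: "\<rho> \<in> borel_measurable M" "\<omega> \<in> borel_measurable M"
  shows "(\<lambda>x. radial_laplacian (\<rho> x) (\<omega> x)) \<in> borel_measurable M"
  unfolding radial_laplacian_def by measurable

lemma radial_kernel_measurable [measurable (raw)]:
  assumes [measurable]: "\<rho> \<in> borel_measurable M" "\<omega> \<in> borel_measurable M"
  shows "(\<lambda>x. radial_kernel (\<rho> x) (\<omega> x)) \<in> borel_measurable M"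
  unfolding radial_kernel_def by measurable

lemma test_function_radial_cutoff_1: "test_function_on UNIV (radial_cutoff k 1)"
  using test_function_radial_cutoff[of 1 0 UNIV k] by simp

lemma radial_cutoff_bounded:
  obtains B where "B > 0" "\<And>r w::'a::euclidean_space. \<bar>radial_cutoff k r w\<bar> \<le> B"
  using test_function_bounded[OF test_function_radial_cutoff_1[of k]] radial_cutoff_scale[of k] by metis

lemma radial_laplacian_bounded:
  obtains B where "B > 0"
    "\<And>r w::'a::euclidean_space. r > 0 \<Longrightarrow> \<bar>radial_laplacian r w\<bar> \<le> B / r\<^sup>2"
proof -
  obtain B1 where B1: "B1 > 0" "\<And>r w::'a. \<bar>radial_cutoff 1 r w\<bar> \<le> B1"
    using radial_cutoff_bounded by blast
  obtain B2 where B2: "B2 > 0" "\<And>r w::'a. \<bar>radial_cutoff 2 r w\<bar> \<le> B2"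
    using radial_cutoff_bounded by blast
  have "\<bar>radial_laplacian r w\<bar> \<le> (B2 + 2 * real DIM('a) * B1) / r\<^sup>2" if "r > 0" for r and w :: 'a
  proof (cases "norm w \<ge> r / 4")
    case True
    then show ?thesis
      using that B1 B2 by (simp add: radial_laplacian_def radial_cutoff_eq_0)
  next
    case False
    \<comment> \<open>The radius is relaxed from r/4 to r/2 so that 4 |w|^2/r^4 is bounded by
      exactly 1/r^2.\<close>
    then have "(norm w)\<^sup>2 \<le> (r / 2)\<^sup>2"
      using that by (intro power_mono) auto
    then have w: "4 * (norm w)\<^sup>2 / r ^ 4 \<le> 1 / r\<^sup>2"
      using that by (simp add: field_simps power2_eq_square power4_eq_xxxx)
    have "\<bar>radial_laplacian r w\<bar> \<le> 4 * (norm w)\<^sup>2 / r ^ 4 * \<bar>radial_cutoff 2 r w\<bar> +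
        2 * real DIM('a) / r\<^sup>2 * \<bar>radial_cutoff 1 r w\<bar>"
      unfolding radial_laplacian_def using that by (intro order_trans[OF abs_triangle_ineq]) (simp add: abs_mult)
    also have "\<dots> \<le> 1 / r\<^sup>2 * B2 + 2 * real DIM('a) / r\<^sup>2 * B1"
      using B1 B2 w by (intro add_mono mult_mono) auto
    also have "\<dots> = (B2 + 2 * real DIM('a) * B1) / r\<^sup>2"
      by (simp add: add_divide_distrib)
    finally show ?thesis .
  qed
  then show ?thesis
    using B1(1) B2(1) by (intro that[of "B2 + 2 * real DIM('a) * B1"]) (auto intro: add_pos_pos)
qed

lemma isCont_radial_laplacian: "r > 0 \<Longrightarrow> isCont (\<lambda>r. radial_laplacian r w) r"
  unfolding radial_laplacian_def radial_cutoff_def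
  by (intro continuous_intros isCont_o2[OF _ DERIV_isCont[OF DERIV_cutoff]]) auto

lemma emeasure_lborel_ball_less_top: "emeasure lborel (ball (c::'a::euclidean_space) r) < top"
  using emeasure_lborel_ball_finite[of c r] by simp

lemma lborel_integral_affine:
  fixes g :: "'a::euclidean_space \<Rightarrow> real"
  assumes [measurable]: "g \<in> borel_measurable borel" and c: "c > 0"
  shows "(\<integral>x. g x \<partial>lborel) = c ^ DIM('a) * (\<integral>x. g (t + c *\<^sub>R x) \<partial>lborel)"
  using c by (subst lborel_affine[of c t]) (simp_all add: integral_density integral_distr)

text \<open>This integral is the factor M multiplying \<open>u p\<close>, and it must be nonzero to
  be divided out. The kernel has one sign and is strictly negative on a ball; zero mass would make
  that ball a null set.\<close>

lemma radial_kernel_integral_neg: "(\<integral>w. radial_kernel 1 (w::'a::euclidean_space) \<partial>lborel) < 0"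
proof -
  let ?k = "\<lambda>w::'a. - radial_kernel 1 w"
  have neg: "?k w > 0" if "norm w < 1 / 4" for w
  proof -
    have "(norm w)\<^sup>2 < (1 / 4)\<^sup>2" using that by (intro power_strict_mono) auto
    then show ?thesis
      using cutoff_1_neg[of "(norm w)\<^sup>2"] by (simp add: radial_kernel_def radial_cutoff_def power2_eq_square)
  qed
  have zero: "?k w = 0" if "norm w \<ge> 1 / 4" for w
    using radial_cutoff_eq_0[of 1 w 1] that by (simp add: radial_kernel_def)
  obtain B where B: "B > 0" "\<And>r w::'a. \<bar>radial_cutoff 1 r w\<bar> \<le> B"
    using radial_cutoff_bounded by blast
  have int: "integrable lborel ?k"
  proof (rule integrableI_bounded_set[where A = "ball 0 (1 / 4)" and B = "2 * B"])
    show "AE w in lborel. w \<in> ball 0 (1 / 4) \<longrightarrow> norm (?k w) \<le> 2 * B"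
      using B by (simp add: radial_kernel_def abs_mult)
    show "AE w in lborel. w \<notin> ball 0 (1 / 4) \<longrightarrow> ?k w = 0"
      using zero by auto
  qed (auto simp: emeasure_lborel_ball_less_top)
  have nn: "?k w \<ge> 0" for w using neg[of w] zero[of w] by (cases "norm w < 1 / 4") auto
  have "(\<integral>w. ?k w \<partial>lborel) \<noteq> 0"
  proof
    assume "(\<integral>w. ?k w \<partial>lborel) = 0"
    then have "AE w in lborel. ?k w = 0"
      using integral_nonneg_eq_0_iff_AE[OF int] nn by simp
    then have "AE w in lborel. (w::'a) \<notin> ball 0 (1 / 4)"
      by (rule AE_mp) (rule AE_I2, use neg in force)
    then have "emeasure lborel (ball (0::'a) (1 / 4)) = 0"
      by (subst (asm) AE_iff_measurable[of "ball 0 (1 / 4)"]) auto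
    then have "measure lborel (ball (0::'a) (1 / 4)) = 0"
      by (simp add: measure_def)
    then show False using content_ball_pos[of "1 / 4" "0::'a"] by simp
  qed
  moreover have "(\<integral>w. ?k w \<partial>lborel) \<ge> 0"
    using nn by (intro Bochner_Integration.integral_nonneg) auto
  ultimately show ?thesis by simp
qed

section \<open>Second differences of the cutoffs\<close>

text \<open>The increments by \<open>v\<close> at \<open>x\<close> and at \<open>y\<close> are
  subtracted: for small \<open>v\<close> this is the difference of two directional derivatives, up
  to the factor |v|. Constants cancel.\<close>

definition second_diff :: "'a::ab_group_add \<Rightarrow> 'a \<Rightarrow> 'a \<Rightarrow> ('a \<Rightarrow> real) \<Rightarrow> real"
  where "second_diff x y v \<phi> = \<phi> (x + v) - \<phi> x - \<phi> (y + v) + \<phi> y"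

lemma second_diff_radial_cutoff_bounds:
  obtains L where "L > 0"
    "\<And>r x y v z::'a::euclidean_space. r > 0 \<Longrightarrow>
      \<bar>second_diff x y v (\<lambda>p. radial_cutoff k r (z - p))\<bar> \<le> L * norm v / r"
    "\<And>r x y v z::'a. r > 0 \<Longrightarrow>
      \<bar>second_diff x y v (\<lambda>p. radial_cutoff k r (z - p))\<bar> \<le> L * norm v * norm (x - y) / r\<^sup>2"
proof -
  obtain L1 where L1: "L1 > 0"
      "\<And>a b::'a. \<bar>radial_cutoff k 1 a - radial_cutoff k 1 b\<bar> \<le> L1 * norm (a - b)"
    using test_function_lipschitz[OF test_function_radial_cutoff_1] by blast
  obtain L2 where L2: "L2 > 0"
      "\<And>a v w::'a. \<bar>radial_cutoff k 1 (a + v + w) - radial_cutoff k 1 (a + v) -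
        radial_cutoff k 1 (a + w) + radial_cutoff k 1 a\<bar> \<le> L2 * norm v * norm w"
    using test_function_second_difference[OF test_function_radial_cutoff_1] by blast
  \<comment> \<open>The constant \<open>2 * L1 + L2\<close> serves both estimates:
    \<open>2 * L1\<close> covers the two separate increments, \<open>L2\<close> the mixed
    difference.\<close>
  have 1: "\<bar>second_diff x y v (\<lambda>p. radial_cutoff k r (z - p))\<bar> \<le> (2 * L1 + L2) * norm v / r"
    if "r > 0" for r and x y v z :: 'a
  proof -
    have "\<bar>radial_cutoff k r (z - (p + v)) - radial_cutoff k r (z - p)\<bar> \<le> L1 * (norm v / r)" for p
      using L1(2)[of "(z - (p + v)) /\<^sub>R r" "(z - p) /\<^sub>R r"] that
      unfolding scaleR_diff_right[symmetric] radial_cutoff_scale[of k r]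
      by (simp add: divide_inverse mult_ac)
    from this[of x] this[of y]
    have "\<bar>second_diff x y v (\<lambda>p. radial_cutoff k r (z - p))\<bar> \<le> 2 * L1 * (norm v / r)"
      unfolding second_diff_def by linarith
    also have "\<dots> \<le> (2 * L1 + L2) * (norm v / r)"
      using L1(1) L2(1) that by (intro mult_right_mono) auto
    finally show ?thesis by simp
  qed
  have 2: "\<bar>second_diff x y v (\<lambda>p. radial_cutoff k r (z - p))\<bar> \<le> (2 * L1 + L2) * norm v * norm (x - y) / r\<^sup>2"
    if "r > 0" for r and x y v z :: 'a
  proof -
    \<comment> \<open>After rescaling, the four arguments are the corners of a parallelogram with
      corner \<open>a\<close> and sides \<open>v\<close> and \<open>x - y\<close>, both divided by
      \<open>r\<close>.\<close>
    define a where "a = (z - x - v) /\<^sub>R r"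
    have "(z - (x + v)) /\<^sub>R r = a" "(z - x) /\<^sub>R r = a + v /\<^sub>R r"
      "(z - (y + v)) /\<^sub>R r = a + (x - y) /\<^sub>R r" "(z - y) /\<^sub>R r = a + v /\<^sub>R r + (x - y) /\<^sub>R r"
      unfolding a_def by (simp_all add: algebra_simps)
    then have "\<bar>second_diff x y v (\<lambda>p. radial_cutoff k r (z - p))\<bar> \<le> L2 * norm (v /\<^sub>R r) * norm ((x - y) /\<^sub>R r)"
      using L2(2)[of a "v /\<^sub>R r" "(x - y) /\<^sub>R r"]
      unfolding second_diff_def radial_cutoff_scale[of k r] by (simp add: algebra_simps)
    also have "\<dots> = L2 * (norm v * norm (x - y) / r\<^sup>2)"
      unfolding norm_scaleR using that by (simp add: power2_eq_square field_simps)
    also have "\<dots> \<le> (2 * L1 + L2) * (norm v * norm (x - y) / r\<^sup>2)"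
      using L1(1) L2(1) that by (intro mult_right_mono) auto
    finally show ?thesis by (simp add: mult_ac)
  qed
  show ?thesis
    by (rule that[OF _ 1 2]) (use L1(1) L2(1) in auto)
qed

lemma second_diff_radial_cutoff_eq_0:
  fixes x y v z :: "'a::euclidean_space"
  assumes "r > 0" "z \<notin> ball x (r / 4) \<union> ball (x + v) (r / 4) \<union> (ball y (r / 4) \<union> ball (y + v) (r / 4))"
  shows "second_diff x y v (\<lambda>p. radial_cutoff k r (z - p)) = 0"
  using assms by (auto simp: second_diff_def radial_cutoff_eq_0 dist_norm norm_minus_commute)

text \<open>A second difference of cutoffs lives on balls around the four centres. Subadditivity
  gives the factor 4 however they overlap, and the resulting power of \<open>r\<close> will cancel
  r^(-n) in the flux.\<close>

lemma abs_integral_le_four_balls: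
  fixes g :: "'a::euclidean_space \<Rightarrow> real"
  assumes [measurable]: "g \<in> borel_measurable borel" and g: "\<And>z. \<bar>g z\<bar> \<le> B" and r: "r \<ge> 0"
    and supp: "\<And>z. z \<notin> ball a r \<union> ball b r \<union> (ball c r \<union> ball d r) \<Longrightarrow> g z = 0"
  shows "\<bar>\<integral>z. g z \<partial>lborel\<bar> \<le> 4 * B * (r ^ DIM('a) * measure lborel (ball (0::'a) 1))"
proof -
  let ?A = "ball a r \<union> ball b r \<union> (ball c r \<union> ball d r)"
  let ?V = "r ^ DIM('a) * measure lborel (ball (0::'a) 1)"
  have B: "B \<ge> 0" using g[of 0] by linarith
  have fin: "emeasure lborel ?A < \<infinity>"
    by (intro emeasure_bounded_finite) (auto intro!: bounded_Un[THEN iffD2])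
  have "\<bar>\<integral>z. g z \<partial>lborel\<bar> \<le> (\<integral>z. \<bar>g z\<bar> \<partial>lborel)"
    using integral_norm_bound[of lborel g] by simp
  also have "\<dots> \<le> (\<integral>z. B * indicator ?A z \<partial>lborel)"
  proof (rule integral_mono')
    show "integrable lborel (\<lambda>z. B * indicator ?A z :: real)"
      using fin by (intro integrable_mult_right integrable_real_indicator) auto
    show "\<bar>g z\<bar> \<le> B * indicator ?A z" for z
      using g[of z] supp[of z] by (auto simp: indicator_def)
  qed (use B in auto)
  also have "\<dots> = B * measure lborel ?A"
    by simp
  also have "\<dots> \<le> B * ((?V + ?V) + (?V + ?V))"
    using content_ball_conv_unit_ball[OF r, where 'a = 'a] B
    by (intro mult_left_mono order_trans[OF measure_Un_le] add_mono) auto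
  finally show ?thesis by simp
qed

section \<open>Representation of the solution by an integral over scales\<close>

text \<open>Real numbers \<open>U\<close> and \<open>F\<close> stand for the suprema, since an
  infinite supremum leaves nothing to prove for distinct points.\<close>

locale bounded_poisson_solution =
  fixes u f :: "'a::euclidean_space \<Rightarrow> real" and U F :: real
  assumes cont_u: "continuous_on (ball 0 1) u"
    and cont_f: "continuous_on (ball 0 1) f"
    and u_bound: "\<And>x. x \<in> ball 0 1 \<Longrightarrow> \<bar>u x\<bar> \<le> U"
    and f_bound: "\<And>x. x \<in> ball 0 1 \<Longrightarrow> \<bar>f x\<bar> \<le> F"
    and weak_eq: "laplace_eq_distributional (ball 0 1) u f"
begin

text \<open>Extension by zero lets the affine substitution and Fubini run over the whole space.
  Wherever the equation is applied, the test function is supported in the unit ball.\<close>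

definition u0 :: "'a \<Rightarrow> real" where "u0 z = indicator (ball 0 1) z * u z"
definition f0 :: "'a \<Rightarrow> real" where "f0 z = indicator (ball 0 1) z * f z"

lemma u0_f0_measurable [measurable]: "u0 \<in> borel_measurable borel" "f0 \<in> borel_measurable borel"
  unfolding u0_def[abs_def] f0_def[abs_def]
  using borel_measurable_continuous_on_indicator[OF _ cont_u]
    borel_measurable_continuous_on_indicator[OF _ cont_f] by simp_all

lemma U_nonneg: "U \<ge> 0" and F_nonneg: "F \<ge> 0"
  using u_bound[of 0] f_bound[of 0] by auto

lemma u0_bound: "\<bar>u0 z\<bar> \<le> U" and f0_bound: "\<bar>f0 z\<bar> \<le> F"
  using u_bound[of z] f_bound[of z] U_nonneg F_nonneg by (auto simp: u0_def f0_def indicator_def)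

lemma integrable_times_bounded:
  fixes k :: "'a \<Rightarrow> real"
  assumes [measurable]: "k \<in> borel_measurable borel" and B: "\<And>z. \<bar>k z\<bar> \<le> B"
  shows "integrable lborel (\<lambda>z. u0 z * k z)" "integrable lborel (\<lambda>z. f0 z * k z)"
proof -
  have "B \<ge> 0" using B[of 0] by linarith
  show "integrable lborel (\<lambda>z. u0 z * k z)"
  proof (rule integrableI_bounded_set[where A = "ball 0 1" and B = "U * B"])
    show "AE z in lborel. z \<in> ball 0 1 \<longrightarrow> norm (u0 z * k z) \<le> U * B"
      using u0_bound B U_nonneg by (auto simp: abs_mult intro!: mult_mono)
    show "AE z in lborel. z \<notin> ball 0 1 \<longrightarrow> u0 z * k z = 0"
      by (auto simp: u0_def)
  qed (auto simp: emeasure_lborel_ball_less_top)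
  show "integrable lborel (\<lambda>z. f0 z * k z)"
  proof (rule integrableI_bounded_set[where A = "ball 0 1" and B = "F * B"])
    show "AE z in lborel. z \<in> ball 0 1 \<longrightarrow> norm (f0 z * k z) \<le> F * B"
      using f0_bound B F_nonneg by (auto simp: abs_mult intro!: mult_mono)
    show "AE z in lborel. z \<notin> ball 0 1 \<longrightarrow> f0 z * k z = 0"
      by (auto simp: f0_def)
  qed (auto simp: emeasure_lborel_ball_less_top)
qed

lemma integrable_u0_radial_kernel: "integrable lborel (\<lambda>z. u0 z * radial_kernel r (z - p))"
proof -
  obtain B where B: "B > 0" "\<And>r w::'a. \<bar>radial_cutoff 1 r w\<bar> \<le> B"
    using radial_cutoff_bounded by blast
  show ?thesis
    using B by (intro integrable_times_bounded[where B = "2 * B / \<bar>r\<bar> ^ DIM('a)"])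
      (auto simp: radial_kernel_def abs_mult power_abs intro!: divide_right_mono)
qed

lemma integrable_f0_radial_cutoff: "integrable lborel (\<lambda>z. f0 z * radial_cutoff k r (z - p))"
proof -
  obtain B where "B > 0" "\<And>r w::'a. \<bar>radial_cutoff k r w\<bar> \<le> B"
    using radial_cutoff_bounded by blast
  then show ?thesis
    by (intro integrable_times_bounded[where B = B]) auto
qed

lemma weak_equation_radial:
  assumes "r > 0" "cball p (r / 4) \<subseteq> ball 0 1"
  shows "(\<integral>z. u0 z * radial_laplacian r (z - p) \<partial>lborel) = (\<integral>z. f0 z * radial_cutoff 0 r (z - p) \<partial>lborel)"
proof -
  have "(LINT z:ball 0 1|lborel. u z * laplacian (\<lambda>z. radial_cutoff 0 r (z - p)) z) =
      (LINT z:ball 0 1|lborel. f z * radial_cutoff 0 r (z - p))"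
    using weak_eq test_function_radial_cutoff[OF assms, of 0]
    unfolding laplace_eq_distributional_def by blast
  then show ?thesis
    by (simp add: laplacian_radial_cutoff[OF assms(1)] set_lebesgue_integral_def u0_def f0_def mult.assoc)
qed

text \<open>Through the weak equation this becomes minus the derivative of \<open>smoothed p\<close>
  in the scale \<open>r\<close>.\<close>

definition source_flux :: "'a \<Rightarrow> real \<Rightarrow> real"
  where "source_flux p r = r / r ^ DIM('a) * (\<integral>z. f0 z * radial_cutoff 0 r (z - p) \<partial>lborel)"

definition smoothed :: "'a \<Rightarrow> real \<Rightarrow> real"
  where "smoothed p r = (\<integral>z. u0 z * radial_kernel r (z - p) \<partial>lborel)"

text \<open>Fubini is applied to one function \<open>G\<close> of scale and position: integrating
  over position turns the weak equation into the flux, integrating over the scale is the fundamental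
  theorem of calculus for the kernel. The cut at \<epsilon> is essential: \<open>G\<close> has order
  r^(-1-n) on a ball of volume of order r^n, which may fail to be integrable down to scale
  0.\<close>

lemma
  assumes \<epsilon>: "0 < \<epsilon>" "\<epsilon> \<le> 1" and p: "cball p (1 / 4) \<subseteq> ball 0 1"
  shows integrable_source_flux: "integrable lborel (\<lambda>r. source_flux p r * indicator {\<epsilon>..1} r)" (is ?int)
    and smoothed_diff: "smoothed p 1 - smoothed p \<epsilon> = - (\<integral>r. source_flux p r * indicator {\<epsilon>..1} r \<partial>lborel)" (is ?eq)
proof -
  define G where "G r z = indicator {\<epsilon>..1} r * (r / r ^ DIM('a)) * (u0 z * radial_laplacian r (z - p))" for r z
  obtain B where B: "B > 0" "\<And>r w::'a. r > 0 \<Longrightarrow> \<bar>radial_laplacian r w\<bar> \<le> B / r\<^sup>2"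
    using radial_laplacian_bounded by blast
  have "integrable (lborel \<Otimes>\<^sub>M lborel) (case_prod G)"
  proof (rule integrableI_bounded_set[where A = "{\<epsilon>..1} \<times> ball 0 1" and B = "1 / \<epsilon> ^ DIM('a) * (U * (B / \<epsilon>\<^sup>2))"])
    show "emeasure (lborel \<Otimes>\<^sub>M lborel) ({\<epsilon>..1} \<times> ball (0::'a) 1) < \<infinity>"
      by (simp add: lborel.emeasure_pair_measure_Times ennreal_mult_less_top emeasure_lborel_ball_less_top
        emeasure_lborel_Icc_eq)
    show "case_prod G \<in> borel_measurable (lborel \<Otimes>\<^sub>M lborel)"
      unfolding G_def by measurable
    have "\<bar>G r z\<bar> \<le> 1 / \<epsilon> ^ DIM('a) * (U * (B / \<epsilon>\<^sup>2))" if "r \<in> {\<epsilon>..1}" for r z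
    proof -
      have r: "r > 0" "r \<le> 1" "\<epsilon> \<le> r" using that \<epsilon> by auto
      have "B / r\<^sup>2 \<le> B / \<epsilon>\<^sup>2"
        using r \<epsilon> B(1) by (intro divide_left_mono power_mono) auto
      then have "\<bar>radial_laplacian r (z - p)\<bar> \<le> B / \<epsilon>\<^sup>2"
        using B(2)[OF r(1)] order_trans by blast
      moreover have "r / r ^ DIM('a) \<le> 1 / \<epsilon> ^ DIM('a)"
        using r \<epsilon> by (intro frac_le power_mono) auto
      ultimately have "r / r ^ DIM('a) * (\<bar>u0 z\<bar> * \<bar>radial_laplacian r (z - p)\<bar>) \<le>
          1 / \<epsilon> ^ DIM('a) * (U * (B / \<epsilon>\<^sup>2))"
        using r u0_bound[of z] U_nonneg \<epsilon> by (intro mult_mono) auto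
      then show ?thesis
        using r that by (simp add: G_def abs_mult)
    qed
    then show "AE x in lborel \<Otimes>\<^sub>M lborel. x \<in> {\<epsilon>..1} \<times> ball 0 1 \<longrightarrow>
        norm (case_prod G x) \<le> 1 / \<epsilon> ^ DIM('a) * (U * (B / \<epsilon>\<^sup>2))"
      by auto
    show "AE x in lborel \<Otimes>\<^sub>M lborel. x \<notin> {\<epsilon>..1} \<times> ball 0 1 \<longrightarrow> case_prod G x = 0"
      by (auto simp: G_def u0_def indicator_def)
  qed (auto intro!: pair_measureI)
  note G = this
  have inner_z: "(\<integral>z. G r z \<partial>lborel) = source_flux p r * indicator {\<epsilon>..1} r" for r
  proof (cases "r \<in> {\<epsilon>..1}")
    case True
    then have "cball p (r / 4) \<subseteq> cball p (1 / 4)" "r > 0" using \<epsilon> by auto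
    then show ?thesis
      using True weak_equation_radial[of r p] p by (simp add: G_def source_flux_def)
  qed (simp add: G_def)
  have inner_r: "(\<integral>r. G r z \<partial>lborel) = - (u0 z * radial_kernel 1 (z - p) - u0 z * radial_kernel \<epsilon> (z - p))" for z
  proof -
    have "(\<integral>r. - (r / r ^ DIM('a) * radial_laplacian r (z - p)) * indicator {\<epsilon>..1} r \<partial>lborel) =
        radial_kernel 1 (z - p) - radial_kernel \<epsilon> (z - p)"
      using \<epsilon> by (intro integral_FTC_Icc_real DERIV_radial_kernel)
        (auto intro!: continuous_intros isCont_radial_laplacian)
    moreover have "G r z = - u0 z * (- (r / r ^ DIM('a) * radial_laplacian r (z - p)) * indicator {\<epsilon>..1} r)" for r
      by (simp add: G_def)
    ultimately show ?thesis
      by (simp only: integral_mult_right_zero) (simp add: algebra_simps)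
  qed
  show ?int
    using lborel_pair.integrable_fst[OF G] unfolding inner_z .
  have "(\<integral>r. source_flux p r * indicator {\<epsilon>..1} r \<partial>lborel) =
      (\<integral>z. - (u0 z * radial_kernel 1 (z - p) - u0 z * radial_kernel \<epsilon> (z - p)) \<partial>lborel)"
    using lborel_pair.Fubini_integral[OF G] unfolding inner_z inner_r by simp
  also have "\<dots> = - (smoothed p 1 - smoothed p \<epsilon>)"
    unfolding smoothed_def
    by (simp add: Bochner_Integration.integral_diff integrable_u0_radial_kernel)
  finally show ?eq by simp
qed

text \<open>The kernels are the rescalings r^(-n) phi_1(w/r) of one integrable function, hence an
  approximate identity of mass M instead of 1.\<close>

lemma smoothed_tendsto:
  assumes p: "p \<in> ball 0 1" and \<epsilon>: "\<And>k. \<epsilon> k > 0" "\<epsilon> \<longlonglongrightarrow> 0"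
  shows "(\<lambda>k. smoothed p (\<epsilon> k)) \<longlonglongrightarrow> u p * (\<integral>w. radial_kernel 1 (w::'a) \<partial>lborel)"
proof -
  have eq: "smoothed p (\<epsilon> k) = (\<integral>w. u0 (p + \<epsilon> k *\<^sub>R w) * radial_kernel 1 w \<partial>lborel)" for k
  proof -
    have "smoothed p (\<epsilon> k) = \<epsilon> k ^ DIM('a) *
        (\<integral>w. u0 (p + \<epsilon> k *\<^sub>R w) * radial_kernel (\<epsilon> k) (p + \<epsilon> k *\<^sub>R w - p) \<partial>lborel)"
      unfolding smoothed_def by (rule lborel_integral_affine) (use \<epsilon> in auto)
    also have "\<dots> = (\<integral>w. \<epsilon> k ^ DIM('a) * (u0 (p + \<epsilon> k *\<^sub>R w) * radial_kernel (\<epsilon> k) (p + \<epsilon> k *\<^sub>R w - p)) \<partial>lborel)"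
      by simp
    also have "\<dots> = (\<integral>w. u0 (p + \<epsilon> k *\<^sub>R w) * radial_kernel 1 w \<partial>lborel)"
      using \<epsilon>(1)[of k] by (intro Bochner_Integration.integral_cong refl)
        (simp add: radial_kernel_def radial_cutoff_scale[of _ "\<epsilon> k"])
    finally show ?thesis .
  qed
  \<comment> \<open>A function that is not integrable has Bochner integral 0 by default, whereas
    this integral is negative.\<close>
  have int: "integrable lborel (radial_kernel 1 :: 'a \<Rightarrow> real)"
    using radial_kernel_integral_neg[where 'a = 'a] not_integrable_integral_eq[of lborel "radial_kernel 1 :: 'a \<Rightarrow> real"]
    by linarith
  have "u0 p = u p" using p by (simp add: u0_def)
  moreover have "(\<lambda>k. \<integral>w. u0 (p + \<epsilon> k *\<^sub>R w) * radial_kernel 1 w \<partial>lborel)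
      \<longlonglongrightarrow> (\<integral>w. u0 p * radial_kernel 1 (w::'a) \<partial>lborel)"
  proof (rule integral_dominated_convergence[where w = "\<lambda>w::'a. U * \<bar>radial_kernel 1 w\<bar>"])
    show "integrable lborel (\<lambda>w::'a. U * \<bar>radial_kernel 1 w\<bar>)"
      using int by simp
    show "AE w in lborel. norm (u0 (p + \<epsilon> k *\<^sub>R w) * radial_kernel 1 w) \<le> U * \<bar>radial_kernel 1 w\<bar>" for k
      using u0_bound by (auto simp: abs_mult intro!: mult_right_mono)
    have "isCont u p"
      using cont_u p by (simp add: continuous_on_eq_continuous_at)
    moreover have "eventually (\<lambda>z. u z = u0 z) (nhds p)"
      using eventually_nhds_in_open[of "ball 0 1" p] p by (auto elim!: eventually_mono simp: u0_def)
    ultimately have "isCont u0 p"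
      by (rule isCont_cong[THEN iffD1, rotated])
    moreover have "(\<lambda>k. p + \<epsilon> k *\<^sub>R w) \<longlonglongrightarrow> p" for w
      using tendsto_add[OF tendsto_const tendsto_scaleR[OF \<epsilon>(2) tendsto_const], of p w] by simp
    ultimately have "(\<lambda>k. u0 (p + \<epsilon> k *\<^sub>R w)) \<longlonglongrightarrow> u0 p" for w
      by (rule isCont_tendsto_compose)
    then show "AE w in lborel. (\<lambda>k. u0 (p + \<epsilon> k *\<^sub>R w) * radial_kernel 1 w) \<longlonglongrightarrow> u0 p * radial_kernel 1 w"
      by (auto intro!: tendsto_intros)
  qed auto
  ultimately show ?thesis unfolding eq by simp
qed


lemma second_diff_integral:
  fixes g :: "'a \<Rightarrow> 'a \<Rightarrow> real"
  assumes "\<And>p. integrable lborel (\<lambda>z. h z * g z p)"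
  shows "second_diff x y v (\<lambda>p. \<integral>z. h z * g z p \<partial>lborel) = (\<integral>z. h z * second_diff x y v (g z) \<partial>lborel)"
  using assms unfolding second_diff_def by (simp add: distrib_left right_diff_distrib)

end

section \<open>Scale by scale estimates for the second difference\<close>

text \<open>Both orders of cutoff occur: \<open>k = 0\<close> in the flux of \<open>f\<close>,
  \<open>k = 1\<close> in the smoothing kernel applied to \<open>u\<close>.\<close>

locale bounded_poisson_solution_second_diff = bounded_poisson_solution +
  fixes x y v :: 'a and L V :: real
  defines "V \<equiv> measure lborel (ball (0::'a) 1)"
  assumes L_pos: "L > 0"
    and first_order: "\<And>k r z. k \<le> 1 \<Longrightarrow> r > 0 \<Longrightarrow>
      \<bar>second_diff x y v (\<lambda>p. radial_cutoff k r (z - p))\<bar> \<le> L * norm v / r"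
    and second_order: "\<And>k r z. k \<le> 1 \<Longrightarrow> r > 0 \<Longrightarrow>
      \<bar>second_diff x y v (\<lambda>p. radial_cutoff k r (z - p))\<bar> \<le> L * norm v * norm (x - y) / r\<^sup>2"
    and x: "x \<in> ball 0 (1 / 2)" and y: "y \<in> ball 0 (1 / 2)"
    and v: "norm v < norm (x - y) / 4"
begin

lemma dist_lt_1: "norm (x - y) < 1"
  using x y norm_triangle_ineq4[of x y] by simp

lemma cball_quarter_subset: "p \<in> {x, x + v, y, y + v} \<Longrightarrow> cball p (1 / 4) \<subseteq> ball 0 1"
proof
  fix z assume p: "p \<in> {x, x + v, y, y + v}" and z: "z \<in> cball p (1 / 4)"
  \<comment> \<open>The unit radius is spent as 1/2 for \<open>x\<close> or \<open>y\<close>, less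
    than 1/4 for \<open>v\<close>, and 1/4 for the cutoff at the largest scale.\<close>
  have "norm p < 3 / 4"
    using p x y v dist_lt_1 norm_triangle_ineq[of x v] norm_triangle_ineq[of y v] by auto
  then show "z \<in> ball 0 1"
    using z norm_triangle_sub[of z p] by (simp add: dist_norm norm_minus_commute)
qed

lemma V_nonneg: "V \<ge> 0"
  by (simp add: V_def)

lemma radial_integral_bound:
  assumes [measurable]: "h \<in> borel_measurable borel" and r: "r > 0" and k: "k \<le> 1"
    and B: "\<And>z. \<bar>h z * second_diff x y v (\<lambda>p. radial_cutoff k r (z - p))\<bar> \<le> B"
  shows "\<bar>\<integral>z. h z * second_diff x y v (\<lambda>p. radial_cutoff k r (z - p)) \<partial>lborel\<bar> \<le> 4 * B * V * r ^ DIM('a)"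
proof -
  have "B \<ge> 0" using B[of 0] by linarith
  have "\<bar>\<integral>z. h z * second_diff x y v (\<lambda>p. radial_cutoff k r (z - p)) \<partial>lborel\<bar> \<le>
      4 * B * ((r / 4) ^ DIM('a) * measure lborel (ball (0::'a) 1))"
  proof (rule abs_integral_le_four_balls[where a = x and b = "x + v" and c = y and d = "y + v"])
    show "(\<lambda>z. h z * second_diff x y v (\<lambda>p. radial_cutoff k r (z - p))) \<in> borel_measurable borel"
      unfolding second_diff_def by measurable
  qed (use r B second_diff_radial_cutoff_eq_0[OF r, of _ x v y k] in auto)
  also have "\<dots> \<le> 4 * B * (r ^ DIM('a) * measure lborel (ball (0::'a) 1))"
    using r \<open>B \<ge> 0\<close> by (intro mult_left_mono mult_right_mono power_mono) auto
  finally show ?thesis by (simp add: V_def mult_ac)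
qed

text \<open>At the fixed scale 1 the second order bound yields both factors |v| and d, and
  \<open>u\<close> enters only through its size. The 8 is 4 balls times the 2 in
  \<open>radial_kernel\<close>.\<close>

lemma second_diff_smoothed_bound:
  "\<bar>second_diff x y v (\<lambda>p. smoothed p 1)\<bar> \<le> 8 * V * L * U * norm (x - y) * norm v"
proof -
  have "second_diff x y v (\<lambda>p. smoothed p 1) =
      (\<integral>z. u0 z * second_diff x y v (\<lambda>p. radial_kernel 1 (z - p)) \<partial>lborel)"
    unfolding smoothed_def by (rule second_diff_integral[OF integrable_u0_radial_kernel])
  also have "\<dots> = (\<integral>z. (2 * u0 z) * second_diff x y v (\<lambda>p. radial_cutoff 1 1 (z - p)) \<partial>lborel)"
    by (simp add: second_diff_def radial_kernel_def algebra_simps)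
  also have "\<bar>\<dots>\<bar> \<le> 4 * (2 * U * (L * norm v * norm (x - y) / 1\<^sup>2)) * V * 1 ^ DIM('a)"
  proof (rule radial_integral_bound)
    show "\<bar>2 * u0 z * second_diff x y v (\<lambda>p. radial_cutoff 1 1 (z - p))\<bar> \<le>
        2 * U * (L * norm v * norm (x - y) / 1\<^sup>2)" for z
      unfolding abs_mult[of "2 * u0 z"]
      using u0_bound[of z] U_nonneg by (intro mult_mono second_order) (auto simp: abs_mult)
  qed auto
  finally show ?thesis by (simp add: mult_ac)
qed

lemma second_diff_source_flux:
  "second_diff x y v (\<lambda>p. source_flux p r) =
    r / r ^ DIM('a) * (\<integral>z. f0 z * second_diff x y v (\<lambda>p. radial_cutoff 0 r (z - p)) \<partial>lborel)"
proof -
  have "second_diff x y v (\<lambda>p. source_flux p r) =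
      r / r ^ DIM('a) * second_diff x y v (\<lambda>p. \<integral>z. f0 z * radial_cutoff 0 r (z - p) \<partial>lborel)"
    unfolding source_flux_def second_diff_def by (simp add: distrib_left right_diff_distrib)
  then show ?thesis
    unfolding second_diff_integral[OF integrable_f0_radial_cutoff] .
qed

text \<open>The powers balance: r^(1-n) from the flux, r^n from the volume of the support and 1/r
  from the Lipschitz bound. The result is constant in \<open>r\<close>, so scales below d contribute
  at most a multiple of F d |v|.\<close>

lemma second_diff_source_flux_bound_small:
  assumes r: "r > 0"
  shows "\<bar>second_diff x y v (\<lambda>p. source_flux p r)\<bar> \<le> 4 * V * L * F * norm v"
proof -
  have "\<bar>\<integral>z. f0 z * second_diff x y v (\<lambda>p. radial_cutoff 0 r (z - p)) \<partial>lborel\<bar> \<le>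
      4 * (F * (L * norm v / r)) * V * r ^ DIM('a)"
  proof (rule radial_integral_bound)
    show "\<bar>f0 z * second_diff x y v (\<lambda>p. radial_cutoff 0 r (z - p))\<bar> \<le> F * (L * norm v / r)" for z
      unfolding abs_mult[of "f0 z"] using f0_bound[of z] F_nonneg r by (intro mult_mono first_order) auto
  qed (use r in auto)
  then have "\<bar>second_diff x y v (\<lambda>p. source_flux p r)\<bar> \<le>
      r / r ^ DIM('a) * (4 * (F * (L * norm v / r)) * V * r ^ DIM('a))"
    unfolding second_diff_source_flux abs_mult using r by (intro mult_mono) auto
  also have "\<dots> = 4 * V * L * F * norm v"
    using r by (simp add: field_simps)
  finally show ?thesis .
qed

text \<open>The kernel of the second difference has mean zero, so \<open>f\<close> may be replaced by its difference
  to the value at the midpoint of \<open>x\<close> and \<open>y\<close>, which lies within \<open>r\<close> of the support of the kernel.\<close>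

lemma second_diff_source_flux_bound_large:
  assumes r: "norm (x - y) \<le> r" "0 < r" "r \<le> 1"
    and W: "\<And>p q. p \<in> ball 0 1 \<Longrightarrow> q \<in> ball 0 1 \<Longrightarrow> dist p q < r \<Longrightarrow> \<bar>f p - f q\<bar> \<le> W"
  shows "\<bar>second_diff x y v (\<lambda>p. source_flux p r)\<bar> \<le> 4 * V * L * norm (x - y) * norm v * (W / r)"
proof -
  define m where "m = (x + y) /\<^sub>R 2"
  let ?S = "\<lambda>z. second_diff x y v (\<lambda>p. radial_cutoff 0 r (z - p))"
  have W0: "W \<ge> 0" using W[of 0 0] r by simp
  have m: "m \<in> ball 0 1"
    using x y norm_triangle_ineq[of x y] by (simp add: m_def)
  have int: "integrable lborel (\<lambda>z. radial_cutoff 0 r (z - p))" for p :: 'a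
  proof -
    obtain B where B: "B > 0" "\<And>r w::'a. \<bar>radial_cutoff 0 r w\<bar> \<le> B"
      using radial_cutoff_bounded by blast
    show ?thesis
      by (rule integrableI_bounded_set[where A = "ball p (r / 4)" and B = B])
        (use B r in \<open>auto simp: emeasure_lborel_ball_less_top dist_norm norm_minus_commute radial_cutoff_eq_0\<close>)
  qed
  have "(\<integral>z. radial_cutoff 0 r (z - p) \<partial>lborel) = (\<integral>z. radial_cutoff 0 r (z::'a) \<partial>lborel)" for p :: 'a
    using lborel_integral_affine[of "\<lambda>z. radial_cutoff 0 r (z - p)" 1 p] by simp
  then have mean0: "(\<integral>z. ?S z \<partial>lborel) = 0"
    using int unfolding second_diff_def by simp
  have int_S: "integrable lborel ?S"
    using int unfolding second_diff_def by auto
  have int_fS: "integrable lborel (\<lambda>z. f0 z * ?S z)"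
    using integrable_f0_radial_cutoff unfolding second_diff_def
    by (simp add: distrib_left right_diff_distrib)
  have "\<bar>(f0 z - f m) * ?S z\<bar> \<le> W * (L * norm v * norm (x - y) / r\<^sup>2)" for z
  proof (cases "z \<in> ball x (r / 4) \<union> ball (x + v) (r / 4) \<union> (ball y (r / 4) \<union> ball (y + v) (r / 4))")
    case True
    then obtain p where p: "p \<in> {x, x + v, y, y + v}" "z \<in> ball p (r / 4)" by auto
    have "z \<in> cball p (1 / 4)"
      using p(2) r by simp
    then have "z \<in> ball 0 1"
      using cball_quarter_subset[OF p(1)] by blast
    moreover have "norm (x - m) = norm (x - y) / 2" "norm (y - m) = norm (x - y) / 2"
    proof -
      have "x - m = (x - y) /\<^sub>R 2" "y - m = (y - x) /\<^sub>R 2"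
        unfolding m_def by (simp_all add: algebra_simps flip: scaleR_add_left)
      then show "norm (x - m) = norm (x - y) / 2" "norm (y - m) = norm (x - y) / 2"
        by (simp_all add: norm_minus_commute)
    qed
    \<comment> \<open>Half the distance d plus |v| < d/4 is below 3d/4, hence below 3r/4; the
      remaining r/4 is the radius of the cutoff around \<open>p\<close>.\<close>
    then have "norm (p - m) < 3 / 4 * r"
      using p(1) v r norm_triangle_ineq[of "x - m" v] norm_triangle_ineq[of "y - m" v]
      by (auto simp: algebra_simps)
    then have "dist z m < r"
      using p(2) dist_triangle[of z m p] by (simp add: dist_norm norm_minus_commute)
    ultimately have "\<bar>f0 z - f m\<bar> \<le> W"
      using W[of z m] m by (simp add: f0_def)
    then show ?thesis
      unfolding abs_mult using W0 r by (intro mult_mono second_order) auto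
  next
    case False
    then show ?thesis
      using second_diff_radial_cutoff_eq_0[OF r(2) False, of 0] W0 L_pos by simp
  qed
  then have "\<bar>\<integral>z. (f0 z - f m) * ?S z \<partial>lborel\<bar> \<le> 4 * (W * (L * norm v * norm (x - y) / r\<^sup>2)) * V * r ^ DIM('a)"
    using r by (intro radial_integral_bound) auto
  moreover have "(\<integral>z. (f0 z - f m) * ?S z \<partial>lborel) = (\<integral>z. f0 z * ?S z \<partial>lborel)"
    using int_S int_fS mean0 by (simp add: left_diff_distrib)
  ultimately have "\<bar>second_diff x y v (\<lambda>p. source_flux p r)\<bar> \<le>
      r / r ^ DIM('a) * (4 * (W * (L * norm v * norm (x - y) / r\<^sup>2)) * V * r ^ DIM('a))"
    unfolding second_diff_source_flux abs_mult[of "r / r ^ DIM('a)"] using r by (intro mult_mono) auto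
  \<comment> \<open>Here r^(1-n) r^n r^(-2) leaves 1/r, the weight in the Dini integral.\<close>
  also have "\<dots> = 4 * V * L * norm (x - y) * norm v * (W / r)"
    using r by (simp add: field_simps power2_eq_square)
  finally show ?thesis .
qed

text \<open>The truncated identity is estimated uniformly in \<epsilon>, and only then does
  \<epsilon> tend to 0, so no integral over all scales down to 0 is formed.\<close>

lemma second_diff_bound:
  assumes I: "I \<ge> 0" "(\<integral>\<^sup>+r\<in>{dist x y..1}. (oscillation_modulus (ball 0 1) f r / ennreal r) \<partial>lborel) = ennreal I"
  shows "\<bar>\<integral>w. radial_kernel 1 (w::'a) \<partial>lborel\<bar> * \<bar>second_diff x y v u\<bar> \<le>
    8 * V * L * (U + F + I) * dist x y * norm v"
proof -
  let ?d = "norm (x - y)"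
  let ?M = "\<integral>w. radial_kernel 1 (w::'a) \<partial>lborel"
  let ?\<omega> = "oscillation_modulus (ball 0 1) f"
  have d: "0 < ?d" "?d < 1"
    using v dist_lt_1 norm_ge_zero[of v] by linarith+
  have \<omega>_le: "?\<omega> r \<le> ennreal (2 * F)" for r
    unfolding oscillation_modulus_def
  proof (intro SUP_least, clarify)
    fix p q :: 'a assume "p \<in> ball 0 1" "q \<in> ball 0 1"
    then show "ennreal \<bar>f p - f q\<bar> \<le> ennreal (2 * F)"
      using f_bound[of p] f_bound[of q] by (intro ennreal_leI) linarith
  qed
  define W where "W r = enn2real (?\<omega> r)" for r
  have \<omega>: "?\<omega> r = ennreal (W r)" for r
    unfolding W_def using le_less_trans[OF \<omega>_le ennreal_less_top] by (simp add: less_top)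
  have mono: "?\<omega> r \<le> ?\<omega> s" if "r \<le> s" for r s
    unfolding oscillation_modulus_def using that by (intro SUP_subset_mono) auto
  \<comment> \<open>Monotonicity is the source of measurability of the modulus.\<close>
  have "mono W"
    unfolding W_def using mono le_less_trans[OF \<omega>_le ennreal_less_top]
    by (intro monoI enn2real_mono)
  then have [measurable]: "W \<in> borel_measurable borel"
    by (rule borel_measurable_mono)
  have W0: "W r \<ge> 0" for r by (simp add: W_def)
  have W: "\<bar>f p - f q\<bar> \<le> W r" if "p \<in> ball 0 1" "q \<in> ball 0 1" "dist p q < r" for p q r
  proof -
    have "ennreal \<bar>f p - f q\<bar> \<le> ?\<omega> r"
      unfolding oscillation_modulus_def using that by (intro SUP_upper2[where i = "(p, q)"]) auto
    then show ?thesis unfolding \<omega> using W0 by simp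
  qed
  define K where "K = 4 * V * L * norm v"
  have K: "K \<ge> 0" using V_nonneg L_pos by (simp add: K_def)
  let ?S = "\<lambda>r. second_diff x y v (\<lambda>p. source_flux p r)"
  let ?w = "\<lambda>r. (?\<omega> r / ennreal r) * indicator {?d..1} r"
  have diff_bound: "\<bar>second_diff x y v (\<lambda>p. smoothed p 1) - second_diff x y v (\<lambda>p. smoothed p \<epsilon>)\<bar> \<le>
      K * F * ?d + K * ?d * I" if \<epsilon>: "0 < \<epsilon>" "\<epsilon> \<le> 1" for \<epsilon>
  proof -
    note int = integrable_source_flux[OF \<epsilon> cball_quarter_subset]
    have eq: "second_diff x y v (\<lambda>p. smoothed p 1) - second_diff x y v (\<lambda>p. smoothed p \<epsilon>) =
        - (\<integral>r. ?S r * indicator {\<epsilon>..1} r \<partial>lborel)"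
    proof -
      have "(\<integral>r. ?S r * indicator {\<epsilon>..1} r \<partial>lborel) =
          second_diff x y v (\<lambda>p. \<integral>r. source_flux p r * indicator {\<epsilon>..1} r \<partial>lborel)"
        using int unfolding second_diff_def by (simp add: distrib_right left_diff_distrib)
      then show ?thesis
        using smoothed_diff[OF \<epsilon> cball_quarter_subset[of x]] smoothed_diff[OF \<epsilon> cball_quarter_subset[of "x + v"]]
          smoothed_diff[OF \<epsilon> cball_quarter_subset[of y]] smoothed_diff[OF \<epsilon> cball_quarter_subset[of "y + v"]]
        unfolding second_diff_def by simp
    qed
    have int_S: "integrable lborel (\<lambda>r. ?S r * indicator {\<epsilon>..1} r)"
      using int unfolding second_diff_def by (simp add: distrib_right left_diff_distrib)
    \<comment> \<open>The majorant does not depend on \<epsilon>. Both of its pieces cover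
      \<open>r = norm (x - y)\<close>, which only enlarges it.\<close>
    have pw: "ennreal \<bar>?S r * indicator {\<epsilon>..1} r\<bar> \<le>
        ennreal (K * F) * indicator {0..?d} r + ennreal (K * ?d) * ?w r" for r
    proof (cases "r \<in> {\<epsilon>..1}")
      case True
      then have r: "0 < r" "r \<le> 1" using \<epsilon> by auto
      show ?thesis
      proof (cases "r < ?d")
        case True
        then show ?thesis
          using r second_diff_source_flux_bound_small[OF r(1)]
          by (auto simp: K_def indicator_def mult_ac intro!: ennreal_leI)
      next
        case False
        then have "\<bar>?S r\<bar> \<le> K * ?d * (W r / r)"
          using second_diff_source_flux_bound_large[of r "W r"] W r by (simp add: K_def mult_ac)
        then have "ennreal \<bar>?S r\<bar> \<le> ennreal (K * ?d * (W r / r))"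
          by (rule ennreal_leI)
        also have "\<dots> = ennreal (K * ?d) * (?\<omega> r / ennreal r)"
          unfolding \<omega> divide_ennreal[OF W0 r(1)] using K W0[of r] r(1)
          by (intro ennreal_mult mult_nonneg_nonneg divide_nonneg_pos) auto
        finally show ?thesis
          using r False by (auto simp: indicator_def intro: order_trans)
      qed
    qed simp
    have "ennreal \<bar>\<integral>r. ?S r * indicator {\<epsilon>..1} r \<partial>lborel\<bar> \<le>
        (\<integral>\<^sup>+r. ennreal \<bar>?S r * indicator {\<epsilon>..1} r\<bar> \<partial>lborel)"
      using integral_norm_bound_ennreal[OF int_S] by simp
    also have "\<dots> \<le> (\<integral>\<^sup>+r. ennreal (K * F) * indicator {0..?d} r + ennreal (K * ?d) * ?w r \<partial>lborel)"
      by (intro nn_integral_mono pw)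
    also have "\<dots> = ennreal (K * F) * ennreal ?d + ennreal (K * ?d) * ennreal I"
      using I(2) unfolding \<omega> dist_norm
      by (subst nn_integral_add) (auto simp: nn_integral_cmult)
    also have "\<dots> = ennreal (K * F * ?d + K * ?d * I)"
      using K F_nonneg I(1) by (simp add: ennreal_mult ennreal_plus)
    finally show ?thesis
      unfolding eq abs_minus_cancel using K F_nonneg I(1) by (subst (asm) ennreal_le_iff) auto
  qed
  define \<epsilon> where "\<epsilon> k = inverse (real (Suc k))" for k
  have \<epsilon>: "\<epsilon> k > 0" "\<epsilon> k \<le> 1" for k
    by (auto simp: \<epsilon>_def inverse_le_1_iff)
  have "\<epsilon> \<longlonglongrightarrow> 0"
    unfolding \<epsilon>_def[abs_def] by (rule LIMSEQ_inverse_real_of_nat)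
  have lim: "(\<lambda>k. smoothed p (\<epsilon> k)) \<longlonglongrightarrow> u p * ?M" if "p \<in> {x, x + v, y, y + v}" for p
    using subsetD[OF cball_quarter_subset[OF that], of p]
    by (intro smoothed_tendsto \<epsilon> \<open>\<epsilon> \<longlonglongrightarrow> 0\<close>) auto
  have "(\<lambda>k. second_diff x y v (\<lambda>p. smoothed p (\<epsilon> k))) \<longlonglongrightarrow> second_diff x y v (\<lambda>p. u p * ?M)"
    unfolding second_diff_def by (intro tendsto_intros lim) auto
  also have "second_diff x y v (\<lambda>p. u p * ?M) = second_diff x y v u * ?M"
    by (simp add: second_diff_def algebra_simps)
  finally have lim: "(\<lambda>k. second_diff x y v (\<lambda>p. smoothed p (\<epsilon> k))) \<longlonglongrightarrow> second_diff x y v u * ?M" .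
  have "\<bar>second_diff x y v u * ?M\<bar> \<le> 8 * V * L * U * ?d * norm v + (K * F * ?d + K * ?d * I)"
  proof (rule tendsto_upperbound[OF tendsto_rabs[OF lim]])
    show "\<forall>\<^sub>F k in sequentially. \<bar>second_diff x y v (\<lambda>p. smoothed p (\<epsilon> k))\<bar> \<le>
        8 * V * L * U * ?d * norm v + (K * F * ?d + K * ?d * I)"
    proof (intro always_eventually allI)
      fix k
      show "\<bar>second_diff x y v (\<lambda>p. smoothed p (\<epsilon> k))\<bar> \<le>
          8 * V * L * U * ?d * norm v + (K * F * ?d + K * ?d * I)"
        using second_diff_smoothed_bound diff_bound[OF \<epsilon>[of k]] by linarith
    qed
  qed simp
  \<comment> \<open>The term with \<open>U\<close> carries the factor 8, those with \<open>F\<close>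
    and \<open>I\<close> only 4; the difference is the nonnegative quantity below.\<close>
  also have "\<dots> \<le> 8 * V * L * (U + F + I) * dist x y * norm v"
  proof -
    have "0 \<le> 4 * V * L * norm v * ?d * (F + I)"
      using V_nonneg L_pos F_nonneg I(1) by simp
    then show ?thesis by (simp add: K_def dist_norm algebra_simps)
  qed
  finally show ?thesis by (simp add: abs_mult mult_ac)
qed

end

section \<open>From second differences to the gradient\<close>

lemma GDERIV_directional:
  assumes "GDERIV u x :> D"
  shows "((\<lambda>h. (u (x + h *\<^sub>R e) - u x) / h) \<longlongrightarrow> e \<bullet> D) (at_right 0)"
proof -
  have "((\<lambda>h::real. x + h *\<^sub>R e) has_derivative (\<lambda>h. h *\<^sub>R e)) (at 0)"
    by (auto intro!: derivative_eq_intros)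
  from has_derivative_compose[OF this, of u "\<lambda>h. h \<bullet> D"] assms
  have "((\<lambda>h. u (x + h *\<^sub>R e)) has_real_derivative e \<bullet> D) (at 0)"
    by (simp add: gderiv_def has_field_derivative_def mult_commute_abs)
  then show ?thesis
    by (simp add: DERIV_def filterlim_at_split)
qed

lemma gradient_diff_bound:
  fixes u :: "'a::euclidean_space \<Rightarrow> real"
  assumes sol: "bounded_poisson_solution u f U F"
    and grad: "GDERIV u x :> Dx" "GDERIV u y :> Dy"
    and xy: "x \<in> ball 0 (1 / 2)" "y \<in> ball 0 (1 / 2)" "x \<noteq> y"
    and L: "L > 0"
      "\<And>k r x y v z::'a. k \<le> 1 \<Longrightarrow> r > 0 \<Longrightarrow>
        \<bar>second_diff x y v (\<lambda>p. radial_cutoff k r (z - p))\<bar> \<le> L * norm v / r"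
      "\<And>k r x y v z::'a. k \<le> 1 \<Longrightarrow> r > 0 \<Longrightarrow>
        \<bar>second_diff x y v (\<lambda>p. radial_cutoff k r (z - p))\<bar> \<le> L * norm v * norm (x - y) / r\<^sup>2"
    and I: "I \<ge> 0" "(\<integral>\<^sup>+r\<in>{dist x y..1}. (oscillation_modulus (ball 0 1) f r / ennreal r) \<partial>lborel) = ennreal I"
  shows "\<bar>\<integral>w. radial_kernel 1 (w::'a) \<partial>lborel\<bar> * norm (Dx - Dy) \<le>
    8 * measure lborel (ball (0::'a) 1) * L * (U + F + I) * dist x y"
proof -
  interpret bounded_poisson_solution u f U F by (rule sol)
  let ?M = "\<bar>\<integral>w. radial_kernel 1 (w::'a) \<partial>lborel\<bar>"
  let ?R = "8 * measure lborel (ball (0::'a) 1) * L * (U + F + I) * dist x y"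
  \<comment> \<open>\<open>sgn\<close> is the zero vector when the gradients agree, hence the norm
    bound below is an inequality; the inner product identity survives that case.\<close>
  define e where "e = sgn (Dx - Dy)"
  have e: "norm e \<le> 1" "e \<bullet> (Dx - Dy) = norm (Dx - Dy)"
    by (cases "Dx = Dy"; simp add: e_def norm_sgn sgn_div_norm dot_square_norm power2_eq_square)+
  have "((\<lambda>h. ?M * \<bar>(u (x + h *\<^sub>R e) - u x) / h - (u (y + h *\<^sub>R e) - u y) / h\<bar>) \<longlongrightarrow>
      ?M * \<bar>e \<bullet> Dx - e \<bullet> Dy\<bar>) (at_right 0)"
    by (intro tendsto_intros GDERIV_directional grad)
  moreover have "\<forall>\<^sub>F h in at_right 0.
      ?M * \<bar>(u (x + h *\<^sub>R e) - u x) / h - (u (y + h *\<^sub>R e) - u y) / h\<bar> \<le> ?R"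
    unfolding eventually_at_right_field
  proof (intro exI[of _ "norm (x - y) / 4"] conjI allI impI)
    show "0 < norm (x - y) / 4" using xy(3) by simp
  next
    \<comment> \<open>The range of \<open>h\<close> is exactly what makes
      \<open>h *\<^sub>R e\<close> an admissible increment \<open>v\<close>.\<close>
    fix h assume h: "0 < h" "h < norm (x - y) / 4"
    have ve: "norm (h *\<^sub>R e) \<le> h" using e(1) h(1) by (simp add: mult_left_le)
    interpret bounded_poisson_solution_second_diff u f U F x y "h *\<^sub>R e" L "measure lborel (ball (0::'a) 1)"
    proof unfold_locales
      show "norm (h *\<^sub>R e) < norm (x - y) / 4"
        using ve h by linarith
    qed (intro L xy(1,2); assumption)+
    have "?M * \<bar>second_diff x y (h *\<^sub>R e) u\<bar> \<le> ?R * norm (h *\<^sub>R e)"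
      using second_diff_bound[OF I] by simp
    also have "\<dots> \<le> ?R * h"
      using ve L(1) U_nonneg F_nonneg I(1) by (intro mult_left_mono) auto
    finally have "?M * (\<bar>second_diff x y (h *\<^sub>R e) u\<bar> / h) \<le> ?R"
      using h(1) by (simp add: field_simps)
    moreover have "\<bar>second_diff x y (h *\<^sub>R e) u\<bar> / h =
        \<bar>(u (x + h *\<^sub>R e) - u x) / h - (u (y + h *\<^sub>R e) - u y) / h\<bar>"
      using h(1) by (simp add: second_diff_def diff_divide_distrib[symmetric] algebra_simps)
    ultimately show "?M * \<bar>(u (x + h *\<^sub>R e) - u x) / h - (u (y + h *\<^sub>R e) - u y) / h\<bar> \<le> ?R"
      by simp
  qed
  ultimately have "?M * \<bar>e \<bullet> Dx - e \<bullet> Dy\<bar> \<le> ?R"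
    by (rule tendsto_upperbound) simp
  then show ?thesis
    using e(2) by (simp add: inner_diff_right)
qed

lemma sup_abs_eq_ennreal:
  assumes "sup_abs S g \<noteq> \<infinity>" "S \<noteq> {}"
  obtains B where "B \<ge> 0" "sup_abs S g = ennreal B" "\<And>x. x \<in> S \<Longrightarrow> \<bar>g x\<bar> \<le> B"
proof -
  obtain B where B: "B \<ge> 0" "sup_abs S g = ennreal B"
    using assms(1) by (cases "sup_abs S g") auto
  have "\<bar>g x\<bar> \<le> B" if "x \<in> S" for x
  proof -
    have "ennreal \<bar>g x\<bar> \<le> ennreal B"
      unfolding B(2)[symmetric] sup_abs_def using that by (rule SUP_upper)
    then show ?thesis using B(1) by simp
  qed
  then show ?thesis using that B by blast
qed

theorem proposition1p5:
  "\<exists>C::real. C > 0 \<and>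
    (\<forall>(u :: real ^ 'n \<Rightarrow> real) Du f.
      C1_with_gradient_on (ball 0 1) u Du \<longrightarrow>
      continuous_on (ball 0 1) f \<longrightarrow>
      laplace_eq_distributional (ball 0 1) u f \<longrightarrow>
      (\<forall>x\<in>ball 0 (1/2). \<forall>y\<in>ball 0 (1/2).
        ennreal (norm (Du x - Du y)) \<le>
          ennreal (C * dist x y) *
            (sup_abs (ball 0 1) u + sup_abs (ball 0 1) f +
             (\<integral>\<^sup>+r\<in>{dist x y..1}. (oscillation_modulus (ball 0 1) f r / ennreal r) \<partial>lborel))))"
proof -
  obtain L0 where L0: "L0 > 0"
    "\<And>r x y v z::real ^ 'n. r > 0 \<Longrightarrow>
      \<bar>second_diff x y v (\<lambda>p. radial_cutoff 0 r (z - p))\<bar> \<le> L0 * norm v / r"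
    "\<And>r x y v z::real ^ 'n. r > 0 \<Longrightarrow>
      \<bar>second_diff x y v (\<lambda>p. radial_cutoff 0 r (z - p))\<bar> \<le> L0 * norm v * norm (x - y) / r\<^sup>2"
    using second_diff_radial_cutoff_bounds by blast
  obtain L1 where L1: "L1 > 0"
    "\<And>r x y v z::real ^ 'n. r > 0 \<Longrightarrow>
      \<bar>second_diff x y v (\<lambda>p. radial_cutoff 1 r (z - p))\<bar> \<le> L1 * norm v / r"
    "\<And>r x y v z::real ^ 'n. r > 0 \<Longrightarrow>
      \<bar>second_diff x y v (\<lambda>p. radial_cutoff 1 r (z - p))\<bar> \<le> L1 * norm v * norm (x - y) / r\<^sup>2"
    using second_diff_radial_cutoff_bounds by blast
  define L where "L = max L0 L1"
  have L_pos: "L > 0" using L0(1) by (simp add: L_def)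
  have L_first: "\<bar>second_diff x y v (\<lambda>p. radial_cutoff k r (z - p))\<bar> \<le> L * norm v / r"
    if "k \<le> 1" "r > 0" for k r and x y v z :: "real ^ 'n"
  proof -
    have "L0 * norm v / r \<le> L * norm v / r" "L1 * norm v / r \<le> L * norm v / r"
      using that(2) by (auto simp: L_def intro!: divide_right_mono mult_right_mono)
    moreover have "k = 0 \<or> k = 1" using that(1) by auto
    ultimately show ?thesis
      using order_trans[OF L0(2)[OF that(2), of x y v z]] order_trans[OF L1(2)[OF that(2), of x y v z]] by blast
  qed
  have L_second: "\<bar>second_diff x y v (\<lambda>p. radial_cutoff k r (z - p))\<bar> \<le> L * norm v * norm (x - y) / r\<^sup>2"
    if "k \<le> 1" "r > 0" for k r and x y v z :: "real ^ 'n"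
  proof -
    have "L0 * norm v * norm (x - y) / r\<^sup>2 \<le> L * norm v * norm (x - y) / r\<^sup>2"
      "L1 * norm v * norm (x - y) / r\<^sup>2 \<le> L * norm v * norm (x - y) / r\<^sup>2"
      by (auto simp: L_def intro!: divide_right_mono mult_right_mono)
    moreover have "k = 0 \<or> k = 1" using that(1) by auto
    ultimately show ?thesis
      using order_trans[OF L0(3)[OF that(2), of x y v z]] order_trans[OF L1(3)[OF that(2), of x y v z]] by blast
  qed
  define M where "M = \<bar>\<integral>w. radial_kernel 1 (w::real ^ 'n) \<partial>lborel\<bar>"
  \<comment> \<open>Fixed before \<open>u\<close> and \<open>f\<close> are chosen: every ingredient
    is determined by the profile and the dimension.\<close>
  define C where "C = 8 * measure lborel (ball (0::real ^ 'n) 1) * L / M"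
  have M: "M > 0"
    unfolding M_def using radial_kernel_integral_neg[where 'a = "real ^ 'n"] by linarith
  have C: "C > 0"
    unfolding C_def using M L_pos content_ball_pos[of 1 "0::real ^ 'n"] by simp
  show ?thesis
  proof (intro exI[of _ C] conjI allI impI ballI)
    fix u :: "real ^ 'n \<Rightarrow> real" and Du f and x y :: "real ^ 'n"
    assume u: "C1_with_gradient_on (ball 0 1) u Du" and f: "continuous_on (ball 0 1) f"
      and eq: "laplace_eq_distributional (ball 0 1) u f"
      and xy: "x \<in> ball 0 (1/2)" "y \<in> ball 0 (1/2)"
    let ?I = "\<integral>\<^sup>+r\<in>{dist x y..1}. (oscillation_modulus (ball 0 1) f r / ennreal r) \<partial>lborel"
    let ?T = "sup_abs (ball 0 1) u + sup_abs (ball 0 1) f + ?I"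
    show "ennreal (norm (Du x - Du y)) \<le> ennreal (C * dist x y) * ?T"
    \<comment> \<open>Zero times infinity is zero in \<open>ennreal\<close>, so the infinite case
      also needs \<open>C * dist x y\<close> to be nonzero. Otherwise all three terms are finite and
      the estimate is one between reals.\<close>
    proof (cases "x = y \<or> ?T = \<infinity>")
      case True
      moreover have "ennreal (C * dist x y) \<noteq> 0" if "x \<noteq> y"
        using C that by simp
      ultimately show ?thesis
        by (cases "x = y") (auto simp: ennreal_mult_top)
    next
      case False
      then have fin: "sup_abs (ball 0 1) u \<noteq> \<infinity>" "sup_abs (ball 0 1) f \<noteq> \<infinity>" "?I \<noteq> \<infinity>"
        by auto
      obtain U where U: "U \<ge> 0" "sup_abs (ball 0 1) u = ennreal U" "\<And>z. z \<in> ball 0 1 \<Longrightarrow> \<bar>u z\<bar> \<le> U"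
        using sup_abs_eq_ennreal[OF fin(1)] by auto
      obtain F where F: "F \<ge> 0" "sup_abs (ball 0 1) f = ennreal F" "\<And>z. z \<in> ball 0 1 \<Longrightarrow> \<bar>f z\<bar> \<le> F"
        using sup_abs_eq_ennreal[OF fin(2)] by auto
      obtain I where I: "I \<ge> 0" "?I = ennreal I"
        using fin(3) by (cases ?I) auto
      have grad: "GDERIV u z :> Du z" if "z \<in> ball 0 1" for z
        using u that by (simp add: C1_with_gradient_on_def)
      then have "isCont u z" if "z \<in> ball 0 1" for z
        using that has_derivative_continuous unfolding gderiv_def by blast
      then have "continuous_on (ball 0 1) u"
        by (intro continuous_at_imp_continuous_on) auto
      then have "bounded_poisson_solution u f U F"
        using f U(3) F(3) eq by unfold_locales
      moreover have "x \<in> ball 0 1" "y \<in> ball 0 1" "x \<noteq> y"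
        using xy False by auto
      ultimately have "M * norm (Du x - Du y) \<le> 8 * measure lborel (ball (0::real ^ 'n) 1) * L * (U + F + I) * dist x y"
        unfolding M_def
        by (rule gradient_diff_bound[OF _ grad grad xy _ L_pos L_first L_second I])
      then have "norm (Du x - Du y) \<le> C * dist x y * (U + F + I)"
        using M by (simp add: C_def field_simps)
      then have "ennreal (norm (Du x - Du y)) \<le> ennreal (C * dist x y * (U + F + I))"
        by (rule ennreal_leI)
      also have "\<dots> = ennreal (C * dist x y) * ?T"
        using C U(1) F(1) I(1) by (simp add: U(2) F(2) I(2) ennreal_mult flip: ennreal_plus)
      finally show ?thesis .
    qed
  qed (rule C)
qed

end
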